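(* Let $m\in\mathbb{N}$, $(n_1,\dots,n_m)\in\mathbb{N}^m$, let $E_1,\dots,E_m,F$ be Banach spaces over $\mathbb{K}$, and let $P\in\mathcal{MP}(^{n_1}E_1,\dots,{}^{n_m}E_m;F)$. Then there is a unique $\check{P}\in\mathcal{L}_s^{(n_1,\dots,n_m)}(^{n_1}E_1,\dots,{}^{n_m}E_m;F)$ such that $$P(x_1,\dots,x_m)=\check{P}(\underbrace{x_1,\dots,x_1}_{n_1},\dots,\underbrace{x_m,\dots,x_m}_{n_m})$$ for all $x_1\in E_1,\dots,x_m\in E_m$.
   Context: $\mathbb{K}=\mathbb{R}$ or $\mathbb{C}$, and $\mathbb{N}=\{1,2,\dots\}$. A mapping $P\colon E_1\times\cdots\times E_m\to F$ is an $(n_1,\dots,n_m)$-homogeneous polynomial if, for each $i=1,\dots,m$ and all fixed $x_k\in E_k$ ($k\neq i$), the mapping $P(x_1,\dots,x_{i-1},\cdot,x_{i+1},\dots,x_m)\colon E_i\to F$ is an $n_i$-homogeneous polynomial (i.e. of the form $x\mapsto A(x,\dots,x)$ with $A\colon E_i^{n_i}\to F$ an $n_i$-linear mapping). $\mathcal{MP}(^{n_1}E_1,\dots,{}^{n_m}E_m;F)$ is the space of all continuous $(n_1,\dots,n_m)$-homogeneous polynomials from $E_1\times\cdots\times E_m$ to $F$. $\mathcal{L}(^{n_1}E_1,\dots,{}^{n_m}E_m;F)$ is the space of continuous $(n_1+\cdots+n_m)$-linear mappings $T\colon E_1^{n_1}\times\cdots\times E_m^{n_m}\to F$. Such a $T$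 is $(n_1,\dots,n_m)$-symmetric if $$T\left(x_{\sigma_1(1)}^{(1)},\dots,x_{\sigma_1(n_1)}^{(1)},\dots,x_{\sigma_m(1)}^{(m)},\dots,x_{\sigma_m(n_m)}^{(m)}\right)=T\left(x_1^{(1)},\dots,x_{n_1}^{(1)},\dots,x_1^{(m)},\dots,x_{n_m}^{(m)}\right)$$ for all $x_k^{(i)}\in E_i$ and all permutations $\sigma_i\in S_{n_i}$, $i=1,\dots,m$. $\mathcal{L}_s^{(n_1,\dots,n_m)}(^{n_1}E_1,\dots,{}^{n_m}E_m;F)$ is the space of continuous $(n_1,\dots,n_m)$-symmetric mappings. *)

theory Defs
  imports
    "HOL-Analysis.Analysis"
    "HOL-Algebra.Module"
    "HOL-Combinatorics.Permutations"
begin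

section \<open>Banach spaces over the real or complex field\<close>

text \<open>
  The spaces \<open>E\<^sub>1, \<dots>, E\<^sub>m\<close> are \<open>m\<close> different spaces, with \<open>m\<close> a variable, so they cannot be
  types. A space is a \<open>module\<close> of HOL-Algebra with a norm, on a carrier set; a family of
  arbitrary spaces is a function from the index set to such records.

  The scalar field is a set of complex numbers, to be taken as \<open>\<real>\<close> or as \<open>UNIV\<close>. For \<open>\<real>\<close>, the
  value of \<open>smult\<close> at non-real scalars is irrelevant.
\<close>

definition scalar_ring :: "complex set \<Rightarrow> complex ring"
  where "scalar_ring K = \<lparr>carrier = K, monoid.mult = (*), one = 1, zero = 0, add = (+)\<rparr>"

record 'a normed_module = "(complex, 'a) module" +
  nrm :: "'a \<Rightarrow> real"

locale normed_vector_space = module "scalar_ring K" E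
  for K :: "complex set" and E :: "'a normed_module" (structure) +
  assumes nrm_nonneg: "x \<in> carrier E \<Longrightarrow> 0 \<le> nrm E x"
    and nrm_eq_0_iff: "x \<in> carrier E \<Longrightarrow> nrm E x = 0 \<longleftrightarrow> x = \<zero>\<^bsub>E\<^esub>"
    and nrm_smult: "\<lbrakk>c \<in> K; x \<in> carrier E\<rbrakk> \<Longrightarrow> nrm E (c \<odot>\<^bsub>E\<^esub> x) = cmod c * nrm E x"
    and nrm_triangle: "\<lbrakk>x \<in> carrier E; y \<in> carrier E\<rbrakk> \<Longrightarrow> nrm E (x \<oplus>\<^bsub>E\<^esub> y) \<le> nrm E x + nrm E y"

text \<open>
  The locale \<open>Metric_space\<close> demands symmetry and nonnegativity also outside the carrier, hence
  the default value 0 there.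
\<close>

definition nrm_dist :: "'a normed_module \<Rightarrow> 'a \<Rightarrow> 'a \<Rightarrow> real"
  where "nrm_dist E x y =
    (if x \<in> carrier E \<and> y \<in> carrier E then nrm E (x \<ominus>\<^bsub>E\<^esub> y) else 0)"

definition nrm_topology :: "'a normed_module \<Rightarrow> 'a topology"
  where "nrm_topology E = Metric_space.mtopology (carrier E) (nrm_dist E)"

locale banach_space = normed_vector_space K E
  for K :: "complex set" and E :: "'a normed_module" (structure) +
  assumes complete: "Metric_space.mcomplete (carrier E) (nrm_dist E)"

lemma (in normed_vector_space) Metric_space_nrm_dist:
  assumes "K = \<real> \<or> K = UNIV"
  shows "Metric_space (carrier E) (nrm_dist E)"
proof
  have m1: "- 1 \<in> K" "1 \<in> K" using assms by auto
  have uminus: "nrm E (\<ominus>\<^bsub>E\<^esub> x) = nrm E x" if x: "x \<in> carrier E" for x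
  proof -
    have "\<ominus>\<^bsub>scalar_ring K\<^esub> \<one>\<^bsub>scalar_ring K\<^esub> = -1"
      using m1 R.minus_equality[of "-1" 1] by (simp add: scalar_ring_def)
    then have "\<ominus>\<^bsub>E\<^esub> x = (-1) \<odot>\<^bsub>E\<^esub> x"
      using smult_l_minus[of "\<one>\<^bsub>scalar_ring K\<^esub>" x] x by simp
    then show ?thesis using nrm_smult[OF m1(1) x] by simp
  qed
  show "0 \<le> nrm_dist E x y" for x y
    by (simp add: nrm_dist_def nrm_nonneg)
  show "nrm_dist E x y = nrm_dist E y x" for x y
  proof (cases "x \<in> carrier E \<and> y \<in> carrier E")
    case True
    then have "x \<ominus>\<^bsub>E\<^esub> y = \<ominus>\<^bsub>E\<^esub> (y \<ominus>\<^bsub>E\<^esub> x)"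
      by (simp add: a_minus_def M.minus_add M.a_comm)
    then show ?thesis using True uminus[of "y \<ominus>\<^bsub>E\<^esub> x"] by (simp add: nrm_dist_def)
  qed (auto simp: nrm_dist_def)
  show "(nrm_dist E x y = 0) = (x = y)" if "x \<in> carrier E" "y \<in> carrier E" for x y
  proof -
    have "x \<ominus>\<^bsub>E\<^esub> y = \<zero>\<^bsub>E\<^esub> \<longleftrightarrow> x = y"
      using that M.minus_equality[of x "\<ominus>\<^bsub>E\<^esub> y"] by (auto simp: a_minus_def M.r_neg)
    then show ?thesis using that by (simp add: nrm_dist_def nrm_eq_0_iff)
  qed
  show "nrm_dist E x z \<le> nrm_dist E x y + nrm_dist E y z"
    if "x \<in> carrier E" "y \<in> carrier E" "z \<in> carrier E" for x y z
  proof -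
    have "x \<ominus>\<^bsub>E\<^esub> z = (x \<ominus>\<^bsub>E\<^esub> y) \<oplus>\<^bsub>E\<^esub> (y \<ominus>\<^bsub>E\<^esub> z)"
      using that by (simp add: a_minus_def M.a_assoc M.r_neg1)
    then show ?thesis
      using that nrm_triangle[of "x \<ominus>\<^bsub>E\<^esub> y" "y \<ominus>\<^bsub>E\<^esub> z"] by (simp add: nrm_dist_def)
  qed
qed


section \<open>Multilinear mappings and homogeneous polynomials\<close>

text \<open>
  The Cartesian product of a family \<open>E\<close> over \<open>I\<close> is an extensional function space, and mappings
  between carriers are extensional as well, so that equality of mappings is equality of functions.
  Updating an arbitrary point of the product at \<open>i\<close> amounts to fixing all other coordinates.
\<close>

abbreviation space_prod :: "'i set \<Rightarrow> ('i \<Rightarrow> 'a normed_module) \<Rightarrow> ('i \<Rightarrow> 'a) set"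
  where "space_prod I E \<equiv> (\<Pi>\<^sub>E i\<in>I. carrier (E i))"

definition linear_map ::
    "complex set \<Rightarrow> 'a normed_module \<Rightarrow> 'b normed_module \<Rightarrow> ('a \<Rightarrow> 'b) \<Rightarrow> bool"
  where "linear_map K E F f \<longleftrightarrow>
    f \<in> carrier E \<rightarrow> carrier F \<and>
    (\<forall>u\<in>carrier E. \<forall>v\<in>carrier E. f (u \<oplus>\<^bsub>E\<^esub> v) = f u \<oplus>\<^bsub>F\<^esub> f v) \<and>
    (\<forall>c\<in>K. \<forall>v\<in>carrier E. f (c \<odot>\<^bsub>E\<^esub> v) = c \<odot>\<^bsub>F\<^esub> f v)"

definition multilinear_maps ::
    "complex set \<Rightarrow> 'i set \<Rightarrow> ('i \<Rightarrow> 'a normed_module) \<Rightarrow> 'b normed_module \<Rightarrow> (('i \<Rightarrow> 'a) \<Rightarrow> 'b) set"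
  where "multilinear_maps K I E F =
    {A \<in> space_prod I E \<rightarrow>\<^sub>E carrier F.
      \<forall>i\<in>I. \<forall>x\<in>space_prod I E. linear_map K (E i) F (\<lambda>v. A (x(i := v)))}"

definition continuous_multimap ::
    "'i set \<Rightarrow> ('i \<Rightarrow> 'a normed_module) \<Rightarrow> 'b normed_module \<Rightarrow> (('i \<Rightarrow> 'a) \<Rightarrow> 'b) \<Rightarrow> bool"
  where "continuous_multimap I E F f \<longleftrightarrow>
    continuous_map (product_topology (\<lambda>i. nrm_topology (E i)) I) (nrm_topology F) f"

definition homogeneous_polynomial ::
    "complex set \<Rightarrow> nat \<Rightarrow> 'a normed_module \<Rightarrow> 'b normed_module \<Rightarrow> ('a \<Rightarrow> 'b) \<Rightarrow> bool"
  where "homogeneous_polynomial K n E F Q \<longleftrightarrow>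
    (\<exists>A\<in>multilinear_maps K {1..n} (\<lambda>_. E) F. \<forall>x\<in>carrier E. Q x = A (\<lambda>k\<in>{1..n}. x))"

definition MP ::
    "complex set \<Rightarrow> nat \<Rightarrow> (nat \<Rightarrow> nat) \<Rightarrow> (nat \<Rightarrow> 'a normed_module) \<Rightarrow> 'b normed_module
      \<Rightarrow> ((nat \<Rightarrow> 'a) \<Rightarrow> 'b) set"
  where "MP K m n E F =
    {P \<in> space_prod {1..m} E \<rightarrow>\<^sub>E carrier F.
      (\<forall>i\<in>{1..m}. \<forall>x\<in>space_prod {1..m} E.
        homogeneous_polynomial K (n i) (E i) F (\<lambda>v. P (x(i := v)))) \<and>
      continuous_multimap {1..m} E F P}"

text \<open>
  The index \<open>(i, k)\<close> with \<open>i \<le> m\<close>, \<open>k \<le> n i\<close> is that of the \<open>k\<close>-th argument from \<open>E i\<close>. The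
  domain \<open>E\<^sub>1\<^bsup>n\<^sub>1\<^esup> \<times> \<dots> \<times> E\<^sub>m\<^bsup>n\<^sub>m\<^esup>\<close> is the product of the family \<open>E \<circ> fst\<close> over these indices.
\<close>

definition block_index :: "nat \<Rightarrow> (nat \<Rightarrow> nat) \<Rightarrow> (nat \<times> nat) set"
  where "block_index m n = (SIGMA i:{1..m}. {1..n i})"

definition continuous_multilinear_maps ::
    "complex set \<Rightarrow> nat \<Rightarrow> (nat \<Rightarrow> nat) \<Rightarrow> (nat \<Rightarrow> 'a normed_module) \<Rightarrow> 'b normed_module
      \<Rightarrow> ((nat \<times> nat \<Rightarrow> 'a) \<Rightarrow> 'b) set"
  where "continuous_multilinear_maps K m n E F =
    {T \<in> multilinear_maps K (block_index m n) (E \<circ> fst) F.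
      continuous_multimap (block_index m n) (E \<circ> fst) F T}"

definition block_symmetric ::
    "nat \<Rightarrow> (nat \<Rightarrow> nat) \<Rightarrow> (nat \<Rightarrow> 'a normed_module) \<Rightarrow> ((nat \<times> nat \<Rightarrow> 'a) \<Rightarrow> 'b) \<Rightarrow> bool"
  where "block_symmetric m n E T \<longleftrightarrow>
    (\<forall>x\<in>space_prod (block_index m n) (E \<circ> fst). \<forall>\<sigma>.
      (\<forall>i\<in>{1..m}. \<sigma> i permutes {1..n i}) \<longrightarrow>
      T (\<lambda>(i, k)\<in>block_index m n. x (i, \<sigma> i k)) = T x)"

definition symmetric_multilinear_maps ::
    "complex set \<Rightarrow> nat \<Rightarrow> (nat \<Rightarrow> nat) \<Rightarrow> (nat \<Rightarrow> 'a normed_module) \<Rightarrow> 'b normed_module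
      \<Rightarrow> ((nat \<times> nat \<Rightarrow> 'a) \<Rightarrow> 'b) set"
  where "symmetric_multilinear_maps K m n E F =
    {T \<in> continuous_multilinear_maps K m n E F. block_symmetric m n E T}"

end

theory Submission
  imports Defs
begin

text \<open>
  Let \<open>B\<close> be the set of all argument positions \<open>(i, k)\<close>. The symmetric map is given by the
  polarization formula: \<open>T(x)\<close> is \<open>1 / (n\<^sub>1! \<cdots> n\<^sub>m!)\<close> times the sum over all \<open>S \<subseteq> B\<close> of
  \<open>(-1)\<^bsup>|B - S|\<^esup> P(y\<^sub>1, \<dots>, y\<^sub>m)\<close>, where \<open>y\<^sub>i\<close> is the sum of the \<open>x(i, k)\<close> with \<open>(i, k) \<in> S\<close>.
  Its continuity and symmetry are evident. If \<open>P\<close> is the diagonal of a multilinear map \<open>A\<close>, then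
  expanding the sums inside \<open>A\<close> and applying inclusion-exclusion leaves only the terms in which
  the arguments are rearranged by a permutation of \<open>B\<close> that respects the blocks. For symmetric \<open>A\<close>
  this gives \<open>T = A\<close>, hence uniqueness; applied to one block at a time, where \<open>P\<close> is such a diagonal
  by hypothesis, it gives linearity of \<open>T\<close> in every argument. On the diagonal, homogeneity of \<open>P\<close>
  reduces the formula to the inclusion-exclusion count of these permutations.
\<close>

section \<open>Finite sums and multilinear maps\<close>

lemma (in abelian_monoid) finsum_Times:
  assumes "finite A" "finite B"
    and "\<And>a b. \<lbrakk>a \<in> A; b \<in> B\<rbrakk> \<Longrightarrow> f (a, b) \<in> carrier G"
  shows "finsum G f (A \<times> B) = (\<Oplus>a\<in>A. \<Oplus>b\<in>B. f (a, b))"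
  using assms(1,3)
proof (induction A rule: finite_induct)
  case (insert a A)
  have "finsum G f (insert a A \<times> B) = finsum G f (Pair a ` B \<union> A \<times> B)"
    by (rule arg_cong[where f = "finsum G f"]) auto
  also have "\<dots> = finsum G f (Pair a ` B) \<oplus> finsum G f (A \<times> B)"
    using insert assms(2) by (intro finsum_Un_disjoint) auto
  also have "finsum G f (Pair a ` B) = (\<Oplus>b\<in>B. f (a, b))"
    using insert by (intro finsum_reindex) (auto simp: inj_on_def)
  finally show ?case using insert by (simp add: Pi_def)
qed simp

lemma (in abelian_monoid) finsum_swap:
  assumes "finite A" "finite B"
    and "\<And>a b. \<lbrakk>a \<in> A; b \<in> B\<rbrakk> \<Longrightarrow> f a b \<in> carrier G"
  shows "(\<Oplus>a\<in>A. \<Oplus>b\<in>B. f a b) = (\<Oplus>b\<in>B. \<Oplus>a\<in>A. f a b)"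
  using assms(1,3)
proof (induction A rule: finite_induct)
  case (insert a A)
  have "(\<Oplus>b\<in>B. \<Oplus>a\<in>insert a A. f a b) = (\<Oplus>b\<in>B. f a b \<oplus> (\<Oplus>a\<in>A. f a b))"
    using insert by (intro finsum_cong') (auto simp: Pi_def)
  also have "\<dots> = (\<Oplus>b\<in>B. f a b) \<oplus> (\<Oplus>b\<in>B. \<Oplus>a\<in>A. f a b)"
    using insert by (intro finsum_addf) auto
  finally show ?case using insert by (simp add: Pi_def)
qed simp

lemma (in abelian_monoid) finsum_single: "f a \<in> carrier G \<Longrightarrow> finsum G f {a} = f a"
  using finsum_insert[of "{}" a f] by simp

lemma (in abelian_monoid) finsum_mem:
  "(\<And>a. a \<in> A \<Longrightarrow> f a \<in> carrier G) \<Longrightarrow> finsum G f A \<in> carrier G"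
  by (rule finsum_closed) auto

lemma (in abelian_monoid) finsum_eqI:
  assumes "\<And>a. a \<in> A \<Longrightarrow> f a = g a" "\<And>a. a \<in> A \<Longrightarrow> g a \<in> carrier G"
  shows "finsum G f A = finsum G g A"
  using assms by (intro finsum_cong') auto

text \<open>With \<open>K\<close> the reals or all complex numbers, the signs, integers and
  reciprocals that occur in the polarization formula are scalars. The rules below restate the module
  laws in ordinary complex arithmetic, which \<open>scalar_ring\<close> hides behind record
  selectors.\<close>

locale normed_space = normed_vector_space K E
  for K :: "complex set" and E :: "'a normed_module" (structure) +
  assumes scalars: "K = \<real> \<or> K = UNIV"
begin

lemma scalar_simps [simp]:
  "0 \<in> K" "1 \<in> K" "-1 \<in> K" "of_nat k \<in> K"
  "a \<in> K \<Longrightarrow> b \<in> K \<Longrightarrow> a * b \<in> K" "a \<in> K \<Longrightarrow> b \<in> K \<Longrightarrow> a + b \<in> K"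
  "a \<in> K \<Longrightarrow> b \<in> K \<Longrightarrow> a / b \<in> K" "a \<in> K \<Longrightarrow> a ^ k \<in> K"
  using scalars by auto

lemma scalar_sum [simp]: "(\<And>i. i \<in> I \<Longrightarrow> c i \<in> K) \<Longrightarrow> sum c I \<in> K"
  using scalars by (auto intro: sum_in_Reals)

lemma scalar_prod [simp]: "(\<And>i. i \<in> I \<Longrightarrow> c i \<in> K) \<Longrightarrow> prod c I \<in> K"
  using scalars by (auto intro: prod_in_Reals)

lemma scale_closed [simp]: "c \<in> K \<Longrightarrow> x \<in> carrier E \<Longrightarrow> c \<odot> x \<in> carrier E"
  using smult_closed[of c x] by (simp add: scalar_ring_def)

lemma scale_add_left: "c \<in> K \<Longrightarrow> d \<in> K \<Longrightarrow> x \<in> carrier E \<Longrightarrow> (c + d) \<odot> x = c \<odot> x \<oplus>\<^bsub>E\<^esub> d \<odot> x"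
  using smult_l_distr[of c d x] by (simp add: scalar_ring_def)

lemma scale_add_right:
  "c \<in> K \<Longrightarrow> x \<in> carrier E \<Longrightarrow> y \<in> carrier E \<Longrightarrow> c \<odot> (x \<oplus>\<^bsub>E\<^esub> y) = c \<odot> x \<oplus>\<^bsub>E\<^esub> c \<odot> y"
  using smult_r_distr[of c x y] by (simp add: scalar_ring_def)

lemma scale_scale: "c \<in> K \<Longrightarrow> d \<in> K \<Longrightarrow> x \<in> carrier E \<Longrightarrow> c \<odot> (d \<odot> x) = (c * d) \<odot> x"
  using smult_assoc1[of c d x] by (simp add: scalar_ring_def)

lemma scale_one [simp]: "x \<in> carrier E \<Longrightarrow> 1 \<odot> x = x"
  using smult_one[of x] by (simp add: scalar_ring_def)

lemma scale_zero_left [simp]: "x \<in> carrier E \<Longrightarrow> 0 \<odot> x = \<zero>\<^bsub>E\<^esub>"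
  using smult_l_null[of x] by (simp add: scalar_ring_def)

lemma scale_zero_right [simp]: "c \<in> K \<Longrightarrow> c \<odot> \<zero>\<^bsub>E\<^esub> = \<zero>\<^bsub>E\<^esub>"
  using smult_r_null[of c] by (simp add: scalar_ring_def)

lemma scale_finsum:
  assumes "finite A" "c \<in> K" "\<And>a. a \<in> A \<Longrightarrow> f a \<in> carrier E"
  shows "c \<odot> finsum E f A = (\<Oplus>\<^bsub>E\<^esub>a\<in>A. c \<odot> f a)"
  using assms finsum_smult_ldistr[of A c f] by (auto simp: scalar_ring_def)

lemma finsum_scale_left:
  assumes "finite A" "\<And>a. a \<in> A \<Longrightarrow> c a \<in> K" "x \<in> carrier E"
  shows "(\<Oplus>\<^bsub>E\<^esub>a\<in>A. c a \<odot> x) = (\<Sum>a\<in>A. c a) \<odot> x"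
  using assms by (induction A rule: finite_induct) (simp_all add: Pi_def scale_add_left)

lemma finsum_const_scale:
  "finite A \<Longrightarrow> x \<in> carrier E \<Longrightarrow> (\<Oplus>\<^bsub>E\<^esub>a\<in>A. x) = of_nat (card A) \<odot> x"
  using finsum_scale_left[of A "\<lambda>_. 1" x] by simp

end

section \<open>Linear maps: finite sums and linear combinations\<close>

lemma linear_map_finsum:
  assumes "normed_space K E" "normed_space K F" "linear_map K E F f"
    and "finite A" "\<And>a. a \<in> A \<Longrightarrow> x a \<in> carrier E"
  shows "f (finsum E x A) = (\<Oplus>\<^bsub>F\<^esub>a\<in>A. f (x a))"
proof -
  interpret E: normed_space K E by fact
  interpret F: normed_space K F by fact
  have f: "f v \<in> carrier F" if "v \<in> carrier E" for v
    using assms(3) that by (auto simp: linear_map_def)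
  \<comment> \<open>Homogeneity with the scalar 0 gives f(0) = 0, which settles the empty
    sum.\<close>
  have "f \<zero>\<^bsub>E\<^esub> = f (0 \<odot>\<^bsub>E\<^esub> \<zero>\<^bsub>E\<^esub>)" by simp
  also have "\<dots> = 0 \<odot>\<^bsub>F\<^esub> f \<zero>\<^bsub>E\<^esub>"
    using assms(3) by (auto simp: linear_map_def simp del: E.scale_zero_left E.scale_zero_right)
  finally have 0: "f \<zero>\<^bsub>E\<^esub> = \<zero>\<^bsub>F\<^esub>" by (simp add: f)
  show ?thesis using assms(4,5)
  proof (induction A rule: finite_induct)
    case (insert a A)
    then have "f (finsum E x (insert a A)) = f (x a \<oplus>\<^bsub>E\<^esub> finsum E x A)" by (simp add: Pi_def)
    also have "\<dots> = f (x a) \<oplus>\<^bsub>F\<^esub> f (finsum E x A)"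
      using assms(3) insert E.finsum_mem[of A x] by (auto simp: linear_map_def)
    finally show ?case using insert by (simp add: Pi_def f)
  qed (simp add: 0)
qed

lemma linear_map_scale:
  assumes F: "normed_space K F" and f: "linear_map K E F f" and c: "c \<in> K"
  shows "linear_map K E F (\<lambda>v. c \<odot>\<^bsub>F\<^esub> f v)"
proof -
  interpret F: normed_space K F by fact
  show ?thesis
    using f c by (simp add: linear_map_def Pi_iff F.scale_add_right F.scale_scale mult.commute)
qed

lemma linear_map_combination:
  assumes F: "normed_space K F"
    and "finite A" "\<And>a. a \<in> A \<Longrightarrow> linear_map K E F (g a)" "\<And>a. a \<in> A \<Longrightarrow> c a \<in> K"
  shows "linear_map K E F (\<lambda>v. \<Oplus>\<^bsub>F\<^esub>a\<in>A. c a \<odot>\<^bsub>F\<^esub> g a v)"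
proof -
  interpret F: normed_space K F by fact
  have g: "g a v \<in> carrier F" if "a \<in> A" "v \<in> carrier E" for a v
    using assms(3)[OF that(1)] that(2) by (auto simp: linear_map_def)
  have add: "(\<Oplus>\<^bsub>F\<^esub>a\<in>A. c a \<odot>\<^bsub>F\<^esub> g a (u \<oplus>\<^bsub>E\<^esub> v)) =
      (\<Oplus>\<^bsub>F\<^esub>a\<in>A. c a \<odot>\<^bsub>F\<^esub> g a u) \<oplus>\<^bsub>F\<^esub> (\<Oplus>\<^bsub>F\<^esub>a\<in>A. c a \<odot>\<^bsub>F\<^esub> g a v)"
    if "u \<in> carrier E" "v \<in> carrier E" for u v
  proof -
    have "g a (u \<oplus>\<^bsub>E\<^esub> v) = g a u \<oplus>\<^bsub>F\<^esub> g a v" if "a \<in> A" for a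
      using assms(3)[OF that] \<open>u \<in> carrier E\<close> \<open>v \<in> carrier E\<close> by (auto simp: linear_map_def)
    then have "(\<Oplus>\<^bsub>F\<^esub>a\<in>A. c a \<odot>\<^bsub>F\<^esub> g a (u \<oplus>\<^bsub>E\<^esub> v)) =
        (\<Oplus>\<^bsub>F\<^esub>a\<in>A. c a \<odot>\<^bsub>F\<^esub> g a u \<oplus>\<^bsub>F\<^esub> c a \<odot>\<^bsub>F\<^esub> g a v)"
      using that assms(4) by (intro F.finsum_eqI) (auto simp: F.scale_add_right g)
    then show ?thesis using that assms(4) by (simp add: g Pi_def F.finsum_addf)
  qed
  have scale: "(\<Oplus>\<^bsub>F\<^esub>a\<in>A. c a \<odot>\<^bsub>F\<^esub> g a (d \<odot>\<^bsub>E\<^esub> v)) = d \<odot>\<^bsub>F\<^esub> (\<Oplus>\<^bsub>F\<^esub>a\<in>A. c a \<odot>\<^bsub>F\<^esub> g a v)"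
    if "d \<in> K" "v \<in> carrier E" for d v
  proof -
    have "g a (d \<odot>\<^bsub>E\<^esub> v) = d \<odot>\<^bsub>F\<^esub> g a v" if "a \<in> A" for a
      using assms(3)[OF that] \<open>d \<in> K\<close> \<open>v \<in> carrier E\<close> by (auto simp: linear_map_def)
    then have "(\<Oplus>\<^bsub>F\<^esub>a\<in>A. c a \<odot>\<^bsub>F\<^esub> g a (d \<odot>\<^bsub>E\<^esub> v)) = (\<Oplus>\<^bsub>F\<^esub>a\<in>A. d \<odot>\<^bsub>F\<^esub> (c a \<odot>\<^bsub>F\<^esub> g a v))"
      using that assms(4) by (intro F.finsum_eqI) (auto simp: F.scale_scale g mult.commute)
    then show ?thesis using that assms(2,4) by (simp add: F.scale_finsum g)
  qed
  show ?thesis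
    using add scale assms(4) by (auto simp: linear_map_def g intro!: F.finsum_mem)
qed

section \<open>Multilinear maps: linearity in one argument and expansion of sums\<close>

lemma multilinear_map_mem:
  "A \<in> multilinear_maps K B E F \<Longrightarrow> x \<in> space_prod B E \<Longrightarrow> A x \<in> carrier F"
  by (auto simp: multilinear_maps_def)

text \<open>\<open>multilinear_maps\<close> speaks of updating a point of the product. Such a point
  needs some value at \<open>b\<close>, which the nonempty carrier provides. The conditional form
  suits inductions in which the other arguments are given by cases.\<close>

lemma multilinear_map_linear:
  assumes "A \<in> multilinear_maps K B E F" "b \<in> B"
    and "\<And>b'. b' \<in> B \<Longrightarrow> b' \<noteq> b \<Longrightarrow> x b' \<in> carrier (E b')"
    and "carrier (E b) \<noteq> {}"
  shows "linear_map K (E b) F (\<lambda>v. A (\<lambda>b'\<in>B. if b' = b then v else x b'))"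
proof -
  obtain v0 where v0: "v0 \<in> carrier (E b)" using assms(4) by blast
  have "(\<lambda>b'\<in>B. if b' = b then v0 else x b') \<in> space_prod B E" (is "?x \<in> _") using assms v0 by auto
  then have "linear_map K (E b) F (\<lambda>v. A (?x(b := v)))"
    using assms(1,2) by (auto simp: multilinear_maps_def)
  moreover have "?x(b := v) = (\<lambda>b'\<in>B. if b' = b then v else x b')" for v
    using assms(2) by (auto simp: restrict_def)
  ultimately show ?thesis by simp
qed

text \<open>The sums are expanded one position at a time, by induction over the set \<open>C\<close>
  of positions already treated. The entries \<open>z\<close> at the other positions have to be
  arbitrary, because expanding at \<open>d\<close> replaces the entry there by a single
  summand.\<close>

lemma multilinear_map_expand:
  fixes E :: "'i \<Rightarrow> 'a normed_module" and F :: "'b normed_module"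
  assumes A: "A \<in> multilinear_maps K B E F" and F: "normed_space K F"
    and E: "\<And>b. b \<in> B \<Longrightarrow> normed_space K (E b)"
    and B: "finite B" and G: "\<And>b. b \<in> B \<Longrightarrow> finite (G b)"
    and y: "\<And>b c. \<lbrakk>b \<in> B; c \<in> G b\<rbrakk> \<Longrightarrow> y b c \<in> carrier (E b)"
  shows "A (\<lambda>b\<in>B. finsum (E b) (y b) (G b)) = (\<Oplus>\<^bsub>F\<^esub>f\<in>Pi\<^sub>E B G. A (\<lambda>b\<in>B. y b (f b)))"
proof -
  interpret F: normed_space K F by fact
  have zero: "carrier (E b) \<noteq> {}" if "b \<in> B" for b
  proof -
    interpret normed_space K "E b" by (rule E) fact
    show ?thesis by auto
  qed
  have sum_mem: "finsum (E b) (y b) (G b) \<in> carrier (E b)" if "b \<in> B" for b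
  proof -
    interpret normed_space K "E b" by (rule E) fact
    show ?thesis using y that by (intro finsum_mem) auto
  qed
  have "A (\<lambda>b\<in>B. if b \<in> C then finsum (E b) (y b) (G b) else z b) =
      (\<Oplus>\<^bsub>F\<^esub>f\<in>Pi\<^sub>E C G. A (\<lambda>b\<in>B. if b \<in> C then y b (f b) else z b))"
    if "C \<subseteq> B" "\<And>b. b \<in> B \<Longrightarrow> z b \<in> carrier (E b)" for C z
    using finite_subset[OF \<open>C \<subseteq> B\<close> B] that
  proof (induction C arbitrary: z rule: finite_induct)
    case empty
    then have "A (restrict z B) \<in> carrier F" by (intro multilinear_map_mem[OF A]) auto
    then show ?case by (simp add: F.finsum_single restrict_def)
  next
    case (insert d C)
    define L where "L v = A (\<lambda>b\<in>B. if b = d then v else if b \<in> C then finsum (E b) (y b) (G b) else z b)" for v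
    have d: "d \<in> B" "C \<subseteq> B" using insert by auto
    have mem: "A (\<lambda>b\<in>B. if b = d then y d c else if b \<in> C then y b (f b) else z b) \<in> carrier F"
      if "c \<in> G d" "f \<in> Pi\<^sub>E C G" for c f
      using that d insert.prems y by (intro multilinear_map_mem[OF A]) (auto simp: PiE_iff)
    have "linear_map K (E d) F L"
      unfolding L_def using d insert.prems sum_mem zero
      by (intro multilinear_map_linear[OF A]) auto
    then have "L (finsum (E d) (y d) (G d)) = (\<Oplus>\<^bsub>F\<^esub>c\<in>G d. L (y d c))"
      using d E F G y by (intro linear_map_finsum) auto
    also have "\<dots> = (\<Oplus>\<^bsub>F\<^esub>c\<in>G d. \<Oplus>\<^bsub>F\<^esub>f\<in>Pi\<^sub>E C G.
        A (\<lambda>b\<in>B. if b = d then y d c else if b \<in> C then y b (f b) else z b))"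
    proof (rule F.finsum_eqI)
      fix c assume c: "c \<in> G d"
      show "(\<Oplus>\<^bsub>F\<^esub>f\<in>Pi\<^sub>E C G.
        A (\<lambda>b\<in>B. if b = d then y d c else if b \<in> C then y b (f b) else z b)) \<in> carrier F"
        using c mem by (intro F.finsum_mem) auto
      \<comment> \<open>After a summand \<open>c\<close> is chosen at \<open>d\<close>, its value
        becomes a fixed entry, so the induction hypothesis for \<open>C\<close> applies with
        \<open>z(d := y d c)\<close>.\<close>
      have *: "(if b = d then y d c else if b \<in> C then t else z b) = 
          (if b \<in> C then t else (z(d := y d c)) b)" for b t
        using insert.hyps by auto
      show "L (y d c) = (\<Oplus>\<^bsub>F\<^esub>f\<in>Pi\<^sub>E C G.
        A (\<lambda>b\<in>B. if b = d then y d c else if b \<in> C then y b (f b) else z b))"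
        unfolding L_def * using insert.prems c d y by (intro insert.IH) auto
    qed
    also have "\<dots> = finsum F (\<lambda>(c, f).
        A (\<lambda>b\<in>B. if b = d then y d c else if b \<in> C then y b (f b) else z b)) (G d \<times> Pi\<^sub>E C G)"
      using d G insert.hyps by (subst F.finsum_Times) (auto intro: finite_PiE mem)
    also have "\<dots> = finsum F (\<lambda>(c, f).
        A (\<lambda>b\<in>B. if b \<in> insert d C then y b ((f(d := c)) b) else z b)) (G d \<times> Pi\<^sub>E C G)"
      by (rule arg_cong[where f = "\<lambda>h. finsum F h (G d \<times> Pi\<^sub>E C G)"])
        (auto intro!: arg_cong[where f = A] simp: restrict_def fun_eq_iff)
    also have "\<dots> = (\<Oplus>\<^bsub>F\<^esub>f\<in>Pi\<^sub>E (insert d C) G. A (\<lambda>b\<in>B. if b \<in> insert d C then y b (f b) else z b))"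
    proof -
      have "(\<lambda>f. A (\<lambda>b\<in>B. if b \<in> insert d C then y b (f b) else z b)) \<in>
          Pi\<^sub>E (insert d C) G \<rightarrow> carrier F"
        using d y insert.prems by (auto simp: PiE_iff intro!: multilinear_map_mem[OF A])
      \<comment> \<open>A choice function on \<open>insert d C\<close> is the same as a choice at
        \<open>d\<close> together with a choice function on \<open>C\<close>.\<close>
      note F.finsum_reindex[OF this[unfolded PiE_insert_eq], OF inj_combinator[OF insert.hyps(2)],
        folded PiE_insert_eq]
      also have "(\<lambda>q. A (\<lambda>b\<in>B. if b \<in> insert d C then y b ((case q of (c, f) \<Rightarrow> f(d := c)) b) else z b)) =
          (\<lambda>(c, f). A (\<lambda>b\<in>B. if b \<in> insert d C then y b ((f(d := c)) b) else z b))"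
        by (rule ext) (simp split: prod.split)
      finally show ?thesis by (rule sym)
    qed
    finally have "L (finsum (E d) (y d) (G d)) =
      (\<Oplus>\<^bsub>F\<^esub>f\<in>Pi\<^sub>E (insert d C) G. A (\<lambda>b\<in>B. if b \<in> insert d C then y b (f b) else z b))" .
    moreover have "A (\<lambda>b\<in>B. if b \<in> insert d C then finsum (E b) (y b) (G b) else z b) =
        L (finsum (E d) (y d) (G d))"
      unfolding L_def by (rule arg_cong[where f = A]) (auto simp: restrict_def fun_eq_iff)
    ultimately show ?case by (rule trans[rotated])
  qed
  \<comment> \<open>For \<open>C = B\<close> the entries \<open>z\<close> no longer occur; they only
    have to lie in the carriers.\<close>
  from this[of B "\<lambda>b. finsum (E b) (y b) (G b)"] sum_mem show ?thesis
    by (simp cong: restrict_cong)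
qed

section \<open>Continuity of the vector space operations\<close>

context normed_space
begin

lemma topspace_nrm_topology: "topspace (nrm_topology E) = carrier E"
proof -
  interpret Metric_space "carrier E" "nrm_dist E" by (rule Metric_space_nrm_dist[OF scalars])
  show ?thesis by (simp add: nrm_topology_def)
qed

text \<open>All points of an open set of \<open>X\<close> are mapped into the carrier, so membership
  in a metric ball becomes an inequality for the norm and the default value 0 of
  \<open>nrm_dist\<close> does not interfere. If some value lies outside the carrier, both sides are
  false.\<close>

lemma continuous_map_nrm_iff:
  "continuous_map X (nrm_topology E) f \<longleftrightarrow>
    (\<forall>x\<in>topspace X. f x \<in> carrier E) \<and>
    (\<forall>x\<in>topspace X. \<forall>\<epsilon>>0. \<exists>U. openin X U \<and> x \<in> U \<and> (\<forall>y\<in>U. nrm E (f x \<ominus>\<^bsub>E\<^esub> f y) < \<epsilon>))"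
proof -
  interpret M: Metric_space "carrier E" "nrm_dist E" by (rule Metric_space_nrm_dist[OF scalars])
  show ?thesis
  proof (cases "\<forall>x\<in>topspace X. f x \<in> carrier E")
    case True
    have "f y \<in> M.mball (f x) \<epsilon> \<longleftrightarrow> nrm E (f x \<ominus>\<^bsub>E\<^esub> f y) < \<epsilon>"
      if "x \<in> topspace X" "openin X U" "y \<in> U" for x y \<epsilon> U
      using that True openin_subset[of X U] by (auto simp: M.in_mball nrm_dist_def)
    then show ?thesis
      unfolding nrm_topology_def M.continuous_map_to_metric using True by (meson)
  next
    case False
    then show ?thesis
      using continuous_map_image_subset_topspace[of X "nrm_topology E" f]
      by (auto simp: topspace_nrm_topology)
  qed
qed

lemma continuous_map_nrm_add:
  assumes "continuous_map X (nrm_topology E) f" "continuous_map X (nrm_topology E) g"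
  shows "continuous_map X (nrm_topology E) (\<lambda>x. f x \<oplus>\<^bsub>E\<^esub> g x)"
proof -
  have mem: "f x \<in> carrier E" "g x \<in> carrier E" if "x \<in> topspace X" for x
    using assms that by (simp_all add: continuous_map_nrm_iff)
  have "\<exists>U. openin X U \<and> x \<in> U \<and> (\<forall>y\<in>U. nrm E ((f x \<oplus>\<^bsub>E\<^esub> g x) \<ominus>\<^bsub>E\<^esub> (f y \<oplus>\<^bsub>E\<^esub> g y)) < \<epsilon>)"
    if x: "x \<in> topspace X" and "\<epsilon> > 0" for x \<epsilon>
  proof -
    have "\<epsilon> / 2 > 0" using \<open>\<epsilon> > 0\<close> by simp
    then obtain U V where U: "openin X U" "x \<in> U" "\<And>y. y \<in> U \<Longrightarrow> nrm E (f x \<ominus>\<^bsub>E\<^esub> f y) < \<epsilon> / 2"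
      and V: "openin X V" "x \<in> V" "\<And>y. y \<in> V \<Longrightarrow> nrm E (g x \<ominus>\<^bsub>E\<^esub> g y) < \<epsilon> / 2"
      using assms x unfolding continuous_map_nrm_iff by meson
    have "nrm E ((f x \<oplus>\<^bsub>E\<^esub> g x) \<ominus>\<^bsub>E\<^esub> (f y \<oplus>\<^bsub>E\<^esub> g y)) < \<epsilon>" if y: "y \<in> U \<inter> V" for y
    proof -
      have "y \<in> topspace X" using y U(1) openin_subset by blast
      note m = mem[OF this] mem[OF x]
      have "(f x \<oplus>\<^bsub>E\<^esub> g x) \<ominus>\<^bsub>E\<^esub> (f y \<oplus>\<^bsub>E\<^esub> g y) = (f x \<ominus>\<^bsub>E\<^esub> f y) \<oplus>\<^bsub>E\<^esub> (g x \<ominus>\<^bsub>E\<^esub> g y)"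
        using m by (simp add: a_minus_def M.minus_add M.a_ac)
      then have "nrm E ((f x \<oplus>\<^bsub>E\<^esub> g x) \<ominus>\<^bsub>E\<^esub> (f y \<oplus>\<^bsub>E\<^esub> g y)) \<le>
          nrm E (f x \<ominus>\<^bsub>E\<^esub> f y) + nrm E (g x \<ominus>\<^bsub>E\<^esub> g y)"
        using m by (simp add: nrm_triangle)
      then show ?thesis using U(3)[of y] V(3)[of y] y by simp
    qed
    then show ?thesis using U V by (intro exI[of _ "U \<inter> V"]) auto
  qed
  then show ?thesis unfolding continuous_map_nrm_iff using mem by blast
qed

lemma continuous_map_nrm_scale:
  assumes "continuous_map X (nrm_topology E) f" "c \<in> K"
  shows "continuous_map X (nrm_topology E) (\<lambda>x. c \<odot> f x)"
proof -
  have mem: "f x \<in> carrier E" if "x \<in> topspace X" for x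
    using assms that by (simp add: continuous_map_nrm_iff)
  have "\<exists>U. openin X U \<and> x \<in> U \<and> (\<forall>y\<in>U. nrm E (c \<odot> f x \<ominus>\<^bsub>E\<^esub> c \<odot> f y) < \<epsilon>)"
    if x: "x \<in> topspace X" and "\<epsilon> > 0" for x \<epsilon>
  proof -
    \<comment> \<open>The added 1 keeps the denominator positive when \<open>c\<close> is 0.\<close>
    have "\<epsilon> / (cmod c + 1) > 0" using \<open>\<epsilon> > 0\<close> by (simp add: add_nonneg_pos)
    then obtain U where U: "openin X U" "x \<in> U"
        "\<And>y. y \<in> U \<Longrightarrow> nrm E (f x \<ominus>\<^bsub>E\<^esub> f y) < \<epsilon> / (cmod c + 1)"
      using assms x unfolding continuous_map_nrm_iff by meson
    have "nrm E (c \<odot> f x \<ominus>\<^bsub>E\<^esub> c \<odot> f y) < \<epsilon>" if y: "y \<in> U" for y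
    proof -
      have "y \<in> topspace X" using y U(1) openin_subset by blast
      note m = mem[OF this] mem[OF x]
      have "c \<odot> f x \<ominus>\<^bsub>E\<^esub> c \<odot> f y = c \<odot> (f x \<ominus>\<^bsub>E\<^esub> f y)"
        using m assms(2) smult_r_minus[of c "f y"]
        by (simp add: a_minus_def scale_add_right scalar_ring_def)
      then have "nrm E (c \<odot> f x \<ominus>\<^bsub>E\<^esub> c \<odot> f y) = cmod c * nrm E (f x \<ominus>\<^bsub>E\<^esub> f y)"
        using m assms(2) by (simp add: nrm_smult)
      also have "\<dots> \<le> (cmod c + 1) * nrm E (f x \<ominus>\<^bsub>E\<^esub> f y)"
        using m by (intro mult_right_mono) (auto simp: nrm_nonneg)
      also have "\<dots> < \<epsilon>"
        using U(3)[OF y] by (simp add: pos_less_divide_eq add_nonneg_pos mult.commute)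
      finally show ?thesis .
    qed
    then show ?thesis using U by blast
  qed
  then show ?thesis unfolding continuous_map_nrm_iff using mem assms(2) by simp
qed

lemma continuous_map_nrm_finsum:
  assumes "finite A" "\<And>a. a \<in> A \<Longrightarrow> continuous_map X (nrm_topology E) (f a)"
  shows "continuous_map X (nrm_topology E) (\<lambda>x. \<Oplus>\<^bsub>E\<^esub>a\<in>A. f a x)"
  using assms
proof (induction A rule: finite_induct)
  case empty
  then show ?case by (simp add: topspace_nrm_topology)
next
  case (insert a A)
  have "continuous_map X (nrm_topology E) (\<lambda>x. f a x \<oplus>\<^bsub>E\<^esub> (\<Oplus>\<^bsub>E\<^esub>a\<in>A. f a x))"
    using insert by (intro continuous_map_nrm_add) auto
  \<comment> \<open>Splitting off a summand requires values in the carrier, which is known only on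
    the topological space; \<open>continuous_map_eq\<close> asks for agreement only there.\<close>
  then show ?case
  proof (rule continuous_map_eq)
    fix x assume "x \<in> topspace X"
    then have "f b x \<in> carrier E" if "b \<in> insert a A" for b
      using insert.prems[OF that] by (simp add: continuous_map_nrm_iff)
    then show "f a x \<oplus>\<^bsub>E\<^esub> (\<Oplus>\<^bsub>E\<^esub>a\<in>A. f a x) = (\<Oplus>\<^bsub>E\<^esub>a\<in>insert a A. f a x)"
      using insert.hyps by (simp add: Pi_def)
  qed
qed

end

section \<open>Polarization\<close>

text \<open>Passing to complements, the supersets of \<open>R\<close> become the subsets
  \<open>U\<close> of \<open>B - R\<close>, and the sum of the signs of all \<open>U\<close> is the
  expanded product of factors (-1) + 1. It vanishes unless the product is empty. With
  \<open>R\<close> the image of a map into \<open>B\<close>, this sum detects surjectivity.\<close>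

lemma sum_supersets_alternating:
  assumes "finite B" "R \<subseteq> B"
  shows "(\<Sum>S\<in>Pow B. if R \<subseteq> S then (-1) ^ card (B - S) else 0) =
    (if R = B then 1 else 0 :: 'c :: comm_ring_1)"
proof -
  have "(\<Sum>S\<in>Pow B. if R \<subseteq> S then (-1) ^ card (B - S) else 0 :: 'c) =
      (\<Sum>S | S \<subseteq> B \<and> R \<subseteq> S. (-1) ^ card (B - S))"
    using assms by (intro sum.mono_neutral_cong_right) auto
  also have "\<dots> = (\<Sum>U\<in>Pow (B - R). (-1) ^ card U)"
    using assms by (intro sum.reindex_bij_witness[of _ "\<lambda>U. B - U" "\<lambda>S. B - S"]) (auto simp: double_diff)
  also have "\<dots> = (\<Prod>x\<in>B - R. (-1) + 1)"
    using assms by (subst prod_add) auto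
  also have "\<dots> = (if R = B then 1 else 0)"
    using assms by (auto simp: power_0_left card_eq_0_iff)
  finally show ?thesis .
qed

text \<open>
  In the application, \<open>p\<close> assigns to an argument position its block.
\<close>

definition fiber_perms :: "'i set \<Rightarrow> ('i \<Rightarrow> 'j) \<Rightarrow> ('i \<Rightarrow> 'i) set"
  where "fiber_perms B p = {f \<in> (\<Pi>\<^sub>E b\<in>B. {c \<in> B. p c = p b}). f ` B = B}"

lemma finite_fiber_maps: "finite B \<Longrightarrow> finite (\<Pi>\<^sub>E b\<in>B. {c \<in> B. p c = p b})"
  by (intro finite_PiE) auto

lemma finite_fiber_perms: "finite B \<Longrightarrow> finite (fiber_perms B p)"
  unfolding fiber_perms_def using finite_fiber_maps[of B p] by simp

text \<open>The identity is such a permutation. Positivity allows division by this number, which for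
  the block map is n_1! ... n_m!.\<close>

lemma card_fiber_perms_pos: "finite B \<Longrightarrow> card (fiber_perms B p) > 0"
proof -
  have "restrict id B \<in> fiber_perms B p" by (auto simp: fiber_perms_def)
  then show "finite B \<Longrightarrow> ?thesis" by (auto simp: card_gt_0_iff finite_fiber_perms)
qed

text \<open>This moves the dependence on \<open>S\<close> from the index set of a sum to a condition
  on \<open>f\<close>, so that sums over \<open>S\<close> and \<open>f\<close> can be
  interchanged.\<close>

lemma fiber_maps_subset:
  assumes "S \<subseteq> B"
  shows "(\<Pi>\<^sub>E b\<in>B. {c \<in> S. p c = p b}) = {f \<in> (\<Pi>\<^sub>E b\<in>B. {c \<in> B. p c = p b}). f ` B \<subseteq> S}"
  unfolding set_eq_iff mem_Collect_eq PiE_iff image_subset_iff using assms by blast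

text \<open>The product counts the fiber-preserving maps from \<open>B\<close> into
  \<open>S\<close>; after interchanging the sums, inclusion-exclusion keeps those that are onto
  \<open>B\<close>. This is the scalar counterpart of \<open>polarization_formula\<close>, for use
  where only homogeneity is available.\<close>

lemma signed_card_fiber_maps:
  assumes B: "finite B"
  shows "(\<Sum>S\<in>Pow B. (-1) ^ card (B - S) * (\<Prod>b\<in>B. of_nat (card {c \<in> S. p c = p b}))) =
    (of_nat (card (fiber_perms B p)) :: 'c :: comm_ring_1)"
proof -
  define \<Phi> where "\<Phi> = (\<Pi>\<^sub>E b\<in>B. {c \<in> B. p c = p b})"
  note [simp] = finite_fiber_maps[OF B, of p, folded \<Phi>_def] B
  have "(\<Sum>S\<in>Pow B. (-1) ^ card (B - S) * (\<Prod>b\<in>B. of_nat (card {c \<in> S. p c = p b}))) =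
      (\<Sum>S\<in>Pow B. \<Sum>f\<in>\<Phi>. if f ` B \<subseteq> S then (-1) ^ card (B - S) else 0 :: 'c)"
  proof (rule sum.cong)
    fix S assume "S \<in> Pow B"
    then have "(\<Prod>b\<in>B. of_nat (card {c \<in> S. p c = p b})) = (of_nat (card {f \<in> \<Phi>. f ` B \<subseteq> S}) :: 'c)"
      using fiber_maps_subset[of S B p] by (simp add: \<Phi>_def flip: of_nat_prod card_PiE)
    then show "(-1) ^ card (B - S) * (\<Prod>b\<in>B. of_nat (card {c \<in> S. p c = p b})) =
        (\<Sum>f\<in>\<Phi>. if f ` B \<subseteq> S then (-1) ^ card (B - S) else 0 :: 'c)"
      by (simp add: sum.If_cases Int_def mult.commute)
  qed simp
  also have "\<dots> = (\<Sum>f\<in>\<Phi>. \<Sum>S\<in>Pow B. if f ` B \<subseteq> S then (-1) ^ card (B - S) else 0)"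
    by (rule sum.swap)
  also have "\<dots> = (\<Sum>f\<in>\<Phi>. if f ` B = B then 1 else 0)"
    by (intro sum.cong refl sum_supersets_alternating) (auto simp: \<Phi>_def PiE_iff)
  also have "\<dots> = of_nat (card (fiber_perms B p))"
    unfolding fiber_perms_def \<Phi>_def[symmetric] by (simp add: sum.If_cases Int_def)
  finally show ?thesis .
qed

text \<open>Position \<open>b\<close> receives only the \<open>x c\<close> with \<open>c\<close> in
  the fiber of \<open>b\<close>, since these lie in the same space. Expanding \<open>A\<close>
  yields one term for each fiber-preserving \<open>f\<close> with image in \<open>S\<close>; after
  interchanging the sums, the coefficient of \<open>f\<close> is the alternating sum over all
  \<open>S\<close> containing its image, which is 1 if \<open>f\<close> is onto and 0 otherwise. No
  symmetry of \<open>A\<close> enters.\<close>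

lemma polarization_formula:
  fixes E :: "'j \<Rightarrow> 'a normed_module" and F :: "'b normed_module"
  assumes A: "A \<in> multilinear_maps K B (E \<circ> p) F" and F: "normed_space K F"
    and E: "\<And>b. b \<in> B \<Longrightarrow> normed_space K (E (p b))"
    and B: "finite B" and x: "x \<in> space_prod B (E \<circ> p)"
  shows "(\<Oplus>\<^bsub>F\<^esub>S\<in>Pow B. (-1) ^ card (B - S) \<odot>\<^bsub>F\<^esub>
      A (\<lambda>b\<in>B. finsum (E (p b)) x {c \<in> S. p c = p b})) =
    (\<Oplus>\<^bsub>F\<^esub>f\<in>fiber_perms B p. A (\<lambda>b\<in>B. x (f b)))"
proof -
  interpret F: normed_space K F by fact
  define \<Phi> where "\<Phi> = (\<Pi>\<^sub>E b\<in>B. {c \<in> B. p c = p b})"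
  note [simp] = finite_fiber_maps[OF B, of p, folded \<Phi>_def] B
  have mem [simp]: "A (\<lambda>b\<in>B. x (f b)) \<in> carrier F" if "f \<in> \<Phi>" for f
  proof (intro multilinear_map_mem[OF A] restrict_PiE_iff[THEN iffD2] ballI)
    fix b assume "b \<in> B"
    then have "f b \<in> B" "p (f b) = p b" using that by (auto simp: \<Phi>_def PiE_iff)
    then show "x (f b) \<in> carrier ((E \<circ> p) b)" using PiE_mem[OF x, of "f b"] by simp
  qed
  have sgn [simp]: "(if Q then (-1) ^ k else 0) \<in> K" for Q k by simp
  have "(\<Oplus>\<^bsub>F\<^esub>S\<in>Pow B. (-1) ^ card (B - S) \<odot>\<^bsub>F\<^esub>
      A (\<lambda>b\<in>B. finsum (E (p b)) x {c \<in> S. p c = p b})) =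
    (\<Oplus>\<^bsub>F\<^esub>S\<in>Pow B. \<Oplus>\<^bsub>F\<^esub>f\<in>\<Phi>. (if f ` B \<subseteq> S then (-1) ^ card (B - S) else 0) \<odot>\<^bsub>F\<^esub> A (\<lambda>b\<in>B. x (f b)))"
  proof (rule F.finsum_eqI)
    fix S assume S: "S \<in> Pow B"
    then have fin: "finite S" using B by (auto intro: finite_subset)
    have "A (\<lambda>b\<in>B. finsum (E (p b)) x {c \<in> S. p c = p b}) =
        (\<Oplus>\<^bsub>F\<^esub>f\<in>(\<Pi>\<^sub>E b\<in>B. {c \<in> S. p c = p b}). A (\<lambda>b\<in>B. x (f b)))"
    proof (rule multilinear_map_expand[OF A F, of "\<lambda>b. {c \<in> S. p c = p b}" "\<lambda>_. x", unfolded o_def])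
      fix b c assume "b \<in> B" "c \<in> {c \<in> S. p c = p b}"
      then show "x c \<in> carrier (E (p b))" using S PiE_mem[OF x, of c] by auto
    qed (use E B fin in simp_all)
    also have "(\<Pi>\<^sub>E b\<in>B. {c \<in> S. p c = p b}) = {f \<in> \<Phi>. f ` B \<subseteq> S}"
      using S unfolding \<Phi>_def by (intro fiber_maps_subset) auto
    finally have eq: "A (\<lambda>b\<in>B. finsum (E (p b)) x {c \<in> S. p c = p b}) =
        (\<Oplus>\<^bsub>F\<^esub>f\<in>{f \<in> \<Phi>. f ` B \<subseteq> S}. A (\<lambda>b\<in>B. x (f b)))" .
    have "(-1) ^ card (B - S) \<odot>\<^bsub>F\<^esub> A (\<lambda>b\<in>B. finsum (E (p b)) x {c \<in> S. p c = p b}) =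
        (\<Oplus>\<^bsub>F\<^esub>f\<in>{f \<in> \<Phi>. f ` B \<subseteq> S}. (-1) ^ card (B - S) \<odot>\<^bsub>F\<^esub> A (\<lambda>b\<in>B. x (f b)))"
      unfolding eq by (rule F.scale_finsum) auto
    \<comment> \<open>Zero coefficients extend the sum to all of \<open>\<Phi>\<close>, an index set
      independent of \<open>S\<close>.\<close>
    also have "\<dots> = (\<Oplus>\<^bsub>F\<^esub>f\<in>\<Phi>. (if f ` B \<subseteq> S then (-1) ^ card (B - S) else 0) \<odot>\<^bsub>F\<^esub> A (\<lambda>b\<in>B. x (f b)))"
      by (intro F.add.finprod_mono_neutral_cong_left) auto
    finally show "(-1) ^ card (B - S) \<odot>\<^bsub>F\<^esub> A (\<lambda>b\<in>B. finsum (E (p b)) x {c \<in> S. p c = p b}) = \<dots>" .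
  qed (intro F.finsum_mem F.scale_closed sgn mem)
  also have "\<dots> = (\<Oplus>\<^bsub>F\<^esub>f\<in>\<Phi>. \<Oplus>\<^bsub>F\<^esub>S\<in>Pow B.
      (if f ` B \<subseteq> S then (-1) ^ card (B - S) else 0) \<odot>\<^bsub>F\<^esub> A (\<lambda>b\<in>B. x (f b)))"
    by (intro F.finsum_swap) auto
  also have "\<dots> = (\<Oplus>\<^bsub>F\<^esub>f\<in>\<Phi>. (if f ` B = B then 1 else 0) \<odot>\<^bsub>F\<^esub> A (\<lambda>b\<in>B. x (f b)))"
  proof (rule F.finsum_eqI)
    fix f assume f: "f \<in> \<Phi>"
    then have "f ` B \<subseteq> B" by (auto simp: \<Phi>_def PiE_iff)
    then show "(\<Oplus>\<^bsub>F\<^esub>S\<in>Pow B. (if f ` B \<subseteq> S then (-1) ^ card (B - S) else 0) \<odot>\<^bsub>F\<^esub> A (\<lambda>b\<in>B. x (f b))) =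
        (if f ` B = B then 1 else 0) \<odot>\<^bsub>F\<^esub> A (\<lambda>b\<in>B. x (f b))"
      using F.finsum_scale_left[of "Pow B" "\<lambda>S. if f ` B \<subseteq> S then (-1) ^ card (B - S) else 0"
          "A (\<lambda>b\<in>B. x (f b))"] sum_supersets_alternating[of B "f ` B", where 'c = complex]
        mem[OF f] sgn B by simp
  qed auto
  also have "\<dots> = (\<Oplus>\<^bsub>F\<^esub>f\<in>fiber_perms B p. A (\<lambda>b\<in>B. x (f b)))"
    unfolding fiber_perms_def \<Phi>_def[symmetric]
    by (intro F.add.finprod_mono_neutral_cong_right) auto
  finally show ?thesis .
qed

section \<open>Homogeneity and polarization in a single variable\<close>

lemma multilinear_map_scale:
  assumes A: "A \<in> multilinear_maps K B E F" and F: "normed_space K F" and B: "finite B"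
    and E: "\<And>b. b \<in> B \<Longrightarrow> normed_space K (E b)"
    and c: "\<And>b. b \<in> B \<Longrightarrow> c b \<in> K" and x: "x \<in> space_prod B E"
  shows "A (\<lambda>b\<in>B. c b \<odot>\<^bsub>E b\<^esub> x b) = (\<Prod>b\<in>B. c b) \<odot>\<^bsub>F\<^esub> A x"
proof -
  interpret F: normed_space K F by fact
  have cx: "c b \<odot>\<^bsub>E b\<^esub> x b \<in> carrier (E b)" if "b \<in> B" for b
  proof -
    interpret normed_space K "E b" by (rule E) fact
    show ?thesis using c[OF that] PiE_mem[OF x that] by simp
  qed
  have "A (\<lambda>b\<in>B. if b \<in> C then c b \<odot>\<^bsub>E b\<^esub> x b else x b) = (\<Prod>b\<in>C. c b) \<odot>\<^bsub>F\<^esub> A x" if "C \<subseteq> B" for C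
    using finite_subset[OF that B] that
  proof (induction C rule: finite_induct)
    case empty
    have "restrict x B = x" using x by (simp add: PiE_restrict)
    then show ?case using multilinear_map_mem[OF A x] by simp
  next
    case (insert d C)
    define L where "L v = A (\<lambda>b\<in>B. if b = d then v else if b \<in> C then c b \<odot>\<^bsub>E b\<^esub> x b else x b)" for v
    have d: "d \<in> B" "x d \<in> carrier (E d)" using insert x by auto
    have "linear_map K (E d) F L"
      unfolding L_def using d cx x by (intro multilinear_map_linear[OF A]) auto
    then have "L (c d \<odot>\<^bsub>E d\<^esub> x d) = c d \<odot>\<^bsub>F\<^esub> L (x d)"
      using c d by (auto simp: linear_map_def)
    also have "L (x d) = A (\<lambda>b\<in>B. if b \<in> C then c b \<odot>\<^bsub>E b\<^esub> x b else x b)"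
      unfolding L_def using insert.hyps by (intro arg_cong[where f = A]) (auto simp: restrict_def fun_eq_iff)
    also have "\<dots> = (\<Prod>b\<in>C. c b) \<odot>\<^bsub>F\<^esub> A x"
      using insert by (intro insert.IH) auto
    also have "c d \<odot>\<^bsub>F\<^esub> \<dots> = (\<Prod>b\<in>insert d C. c b) \<odot>\<^bsub>F\<^esub> A x"
      using insert c d multilinear_map_mem[OF A x] by (subst F.scale_scale) (auto intro!: F.scalar_prod)
    finally have "L (c d \<odot>\<^bsub>E d\<^esub> x d) = (\<Prod>b\<in>insert d C. c b) \<odot>\<^bsub>F\<^esub> A x" .
    moreover have "A (\<lambda>b\<in>B. if b \<in> insert d C then c b \<odot>\<^bsub>E b\<^esub> x b else x b) = L (c d \<odot>\<^bsub>E d\<^esub> x d)"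
      unfolding L_def by (rule arg_cong[where f = A]) (auto simp: restrict_def fun_eq_iff)
    ultimately show ?case by (rule trans[rotated])
  qed
  from this[of B] show ?thesis by (simp cong: restrict_cong)
qed

lemma homogeneous_polynomial_scale:
  assumes Q: "homogeneous_polynomial K n E F Q" and E: "normed_space K E" and F: "normed_space K F"
    and c: "c \<in> K" and x: "x \<in> carrier E"
  shows "Q (c \<odot>\<^bsub>E\<^esub> x) = c ^ n \<odot>\<^bsub>F\<^esub> Q x"
proof -
  interpret E: normed_space K E by fact
  obtain A where A: "A \<in> multilinear_maps K {1..n} (\<lambda>_. E) F"
    and QA: "\<And>x. x \<in> carrier E \<Longrightarrow> Q x = A (\<lambda>k\<in>{1..n}. x)"
    using Q unfolding homogeneous_polynomial_def by blast
  have "A (\<lambda>k\<in>{1..n}. c \<odot>\<^bsub>E\<^esub> (\<lambda>k\<in>{1..n}. x) k) = (\<Prod>k\<in>{1..n}. c) \<odot>\<^bsub>F\<^esub> A (\<lambda>k\<in>{1..n}. x)"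
    using E c x by (intro multilinear_map_scale[OF A F]) auto
  then show ?thesis using c x by (simp add: QA cong: restrict_cong)
qed

lemma linear_map_cong:
  assumes "normed_space K E" "linear_map K E F g" "\<And>v. v \<in> carrier E \<Longrightarrow> f v = g v"
  shows "linear_map K E F f"
proof -
  interpret normed_space K E by fact
  show ?thesis using assms(2,3) by (auto simp: linear_map_def Pi_iff)
qed

text \<open>By \<open>polarization_formula\<close>, the sum equals a sum of values of
  \<open>A\<close> at rearrangements of the arguments. Each rearrangement contains \<open>v\<close>
  exactly once, so each term is linear in \<open>v\<close>. This handles one block of a
  multi-homogeneous polynomial with all other variables fixed.\<close>

lemma homogeneous_polynomial_polar_linear:
  assumes Q: "homogeneous_polynomial K n E F Q" and E: "normed_space K E" and F: "normed_space K F"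
    and k0: "k0 \<in> {1..n}" and x: "\<And>k. k \<in> {1..n} \<Longrightarrow> x k \<in> carrier E"
  shows "linear_map K E F (\<lambda>v. \<Oplus>\<^bsub>F\<^esub>S\<in>Pow {1..n}. (-1) ^ card ({1..n} - S) \<odot>\<^bsub>F\<^esub>
    Q (finsum E (\<lambda>k. if k = k0 then v else x k) S))"
proof -
  interpret E: normed_space K E by fact
  interpret F: normed_space K F by fact
  obtain A where A: "A \<in> multilinear_maps K {1..n} (\<lambda>_. E) F"
    and QA: "\<And>x. x \<in> carrier E \<Longrightarrow> Q x = A (\<lambda>k\<in>{1..n}. x)"
    using Q unfolding homogeneous_polynomial_def by blast
  define w where "w v = (\<lambda>k\<in>{1..n}. if k = k0 then v else x k)" for v
  \<comment> \<open>The constant map has a single fiber, so \<open>\<Psi>\<close> consists of all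
    permutations of the \<open>n\<close> positions.\<close>
  define \<Psi> where "\<Psi> = fiber_perms {1..n} (\<lambda>_. ())"
  have lin: "linear_map K E F (\<lambda>v. A (\<lambda>k\<in>{1..n}. w v (f k)))" if "f \<in> \<Psi>" for f
  proof -
    have f: "f ` {1..n} = {1..n}" using that by (auto simp: \<Psi>_def fiber_perms_def)
    \<comment> \<open>\<open>k1\<close> is the position to which the rearrangement by
      \<open>f\<close> moves \<open>v\<close>; it is unique because \<open>f\<close>, being onto a
      finite set, is injective.\<close>
    then obtain k1 where k1: "k1 \<in> {1..n}" "f k1 = k0" using k0 by (metis imageE)
    have inj: "inj_on f {1..n}" using f by (intro eq_card_imp_inj_on) auto
    have fk: "f k \<in> {1..n}" "f k = k0 \<longleftrightarrow> k = k1" if "k \<in> {1..n}" for k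
    proof -
      show "f k \<in> {1..n}" using f that by blast
      show "f k = k0 \<longleftrightarrow> k = k1" using that k1 inj_onD[OF inj, of k k1] by metis
    qed
    have "(\<lambda>k\<in>{1..n}. w v (f k)) = (\<lambda>k\<in>{1..n}. if k = k1 then v else x (f k))" for v
    proof (rule restrict_ext)
      fix k assume k: "k \<in> {1..n}"
      have "w v (f k) = (if f k = k0 then v else x (f k))"
        unfolding w_def by (rule restrict_apply'[OF fk(1)[OF k]])
      then show "w v (f k) = (if k = k1 then v else x (f k))" by (simp only: fk(2)[OF k])
    qed
    moreover have "linear_map K E F (\<lambda>v. A (\<lambda>k\<in>{1..n}. if k = k1 then v else x (f k)))"
      using x fk(1) by (intro multilinear_map_linear[OF A k1(1)]) blast+
    ultimately show ?thesis by (simp only:)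
  qed
  \<comment> \<open>The coefficients 1 give the sum the shape required by
    \<open>linear_map_combination\<close>.\<close>
  have "(\<Oplus>\<^bsub>F\<^esub>S\<in>Pow {1..n}. (-1) ^ card ({1..n} - S) \<odot>\<^bsub>F\<^esub>
      Q (finsum E (\<lambda>k. if k = k0 then v else x k) S)) =
    (\<Oplus>\<^bsub>F\<^esub>f\<in>\<Psi>. 1 \<odot>\<^bsub>F\<^esub> A (\<lambda>k\<in>{1..n}. w v (f k)))" if v: "v \<in> carrier E" for v
  proof -
    have w: "w v \<in> space_prod {1..n} ((\<lambda>_. E) \<circ> (\<lambda>_. ()))" using v x by (auto simp: w_def)
    have sum: "finsum E (\<lambda>k. if k = k0 then v else x k) S = finsum E (w v) S"
      "finsum E (w v) S \<in> carrier E" if "S \<in> Pow {1..n}" for S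
      using that v x by (auto intro!: E.finsum_eqI E.finsum_mem simp: w_def)
    have "(\<Oplus>\<^bsub>F\<^esub>S\<in>Pow {1..n}. (-1) ^ card ({1..n} - S) \<odot>\<^bsub>F\<^esub>
        Q (finsum E (\<lambda>k. if k = k0 then v else x k) S)) =
      (\<Oplus>\<^bsub>F\<^esub>S\<in>Pow {1..n}. (-1) ^ card ({1..n} - S) \<odot>\<^bsub>F\<^esub> A (\<lambda>k\<in>{1..n}. finsum E (w v) S))"
    proof (rule F.finsum_eqI)
      fix S assume S: "S \<in> Pow {1..n}"
      then show "(-1) ^ card ({1..n} - S) \<odot>\<^bsub>F\<^esub> Q (finsum E (\<lambda>k. if k = k0 then v else x k) S) =
          (-1) ^ card ({1..n} - S) \<odot>\<^bsub>F\<^esub> A (\<lambda>k\<in>{1..n}. finsum E (w v) S)"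
        by (simp only: sum QA)
      show "(-1) ^ card ({1..n} - S) \<odot>\<^bsub>F\<^esub> A (\<lambda>k\<in>{1..n}. finsum E (w v) S) \<in> carrier F"
        using sum(2)[OF S] by (intro F.scale_closed multilinear_map_mem[OF A]) auto
    qed
    also have "\<dots> = (\<Oplus>\<^bsub>F\<^esub>f\<in>\<Psi>. A (\<lambda>k\<in>{1..n}. w v (f k)))"
      using polarization_formula[OF _ F _ _ w] A E by (simp add: \<Psi>_def o_def)
    also have "\<dots> = (\<Oplus>\<^bsub>F\<^esub>f\<in>\<Psi>. 1 \<odot>\<^bsub>F\<^esub> A (\<lambda>k\<in>{1..n}. w v (f k)))"
    proof (rule F.finsum_eqI)
      fix f assume "f \<in> \<Psi>"
      then have "A (\<lambda>k\<in>{1..n}. w v (f k)) \<in> carrier F" using lin[of f] v by (auto simp: linear_map_def)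
      then show "A (\<lambda>k\<in>{1..n}. w v (f k)) = 1 \<odot>\<^bsub>F\<^esub> A (\<lambda>k\<in>{1..n}. w v (f k))"
        "1 \<odot>\<^bsub>F\<^esub> A (\<lambda>k\<in>{1..n}. w v (f k)) \<in> carrier F" by simp_all
    qed
    finally show ?thesis .
  qed
  moreover have "linear_map K E F (\<lambda>v. \<Oplus>\<^bsub>F\<^esub>f\<in>\<Psi>. 1 \<odot>\<^bsub>F\<^esub> A (\<lambda>k\<in>{1..n}. w v (f k)))"
  proof (rule linear_map_combination[OF F _ lin])
    show "finite \<Psi>" by (simp add: \<Psi>_def finite_fiber_perms)
  qed simp_all
  ultimately show ?thesis by (rule linear_map_cong[OF E, rotated])
qed

section \<open>The symmetric multilinear map of a multi-homogeneous polynomial\<close>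

lemma finite_block_index: "finite (block_index m n)"
  by (simp add: block_index_def)

definition block_sums ::
    "nat \<Rightarrow> (nat \<Rightarrow> 'a normed_module) \<Rightarrow> (nat \<times> nat) set \<Rightarrow> (nat \<times> nat \<Rightarrow> 'a) \<Rightarrow> nat \<Rightarrow> 'a"
  where "block_sums m E S x = (\<lambda>i\<in>{1..m}. finsum (E i) x {c \<in> S. fst c = i})"

definition polar_sum ::
    "nat \<Rightarrow> (nat \<Rightarrow> nat) \<Rightarrow> (nat \<Rightarrow> 'a normed_module) \<Rightarrow> 'b normed_module
      \<Rightarrow> ((nat \<Rightarrow> 'a) \<Rightarrow> 'b) \<Rightarrow> (nat \<times> nat \<Rightarrow> 'a) \<Rightarrow> 'b"
  where "polar_sum m n E F P x = (\<Oplus>\<^bsub>F\<^esub>S\<in>Pow (block_index m n).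
    (-1) ^ card (block_index m n - S) \<odot>\<^bsub>F\<^esub> P (block_sums m E S x))"

text \<open>The denominator equals n_1! ... n_m!. Written as the number of block-preserving
  permutations, it cancels against the counts produced by polarization without being
  evaluated.\<close>

definition polar_form ::
    "nat \<Rightarrow> (nat \<Rightarrow> nat) \<Rightarrow> (nat \<Rightarrow> 'a normed_module) \<Rightarrow> 'b normed_module
      \<Rightarrow> ((nat \<Rightarrow> 'a) \<Rightarrow> 'b) \<Rightarrow> (nat \<times> nat \<Rightarrow> 'a) \<Rightarrow> 'b"
  where "polar_form m n E F P = (\<lambda>x\<in>space_prod (block_index m n) (E \<circ> fst).
    (1 / of_nat (card (fiber_perms (block_index m n) fst))) \<odot>\<^bsub>F\<^esub> polar_sum m n E F P x)"

text \<open>A permutation of the positions that preserves the first component acts on each block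
  separately, so it splits into a family of permutations as in
  \<open>block_symmetric\<close>.\<close>

lemma symmetric_fiber_perm:
  assumes T: "block_symmetric m n E T" and f: "f \<in> fiber_perms (block_index m n) fst"
    and x: "x \<in> space_prod (block_index m n) (E \<circ> fst)"
  shows "T (\<lambda>b\<in>block_index m n. x (f b)) = T x"
proof -
  \<comment> \<open>Outside its block \<open>\<sigma> i\<close> has to be the identity, as
    \<open>permutes\<close> demands.\<close>
  define \<sigma> where "\<sigma> i k = (if (i, k) \<in> block_index m n then snd (f (i, k)) else k)" for i k
  have fB: "f ` block_index m n = block_index m n" using f by (simp add: fiber_perms_def)
  have inj: "inj_on f (block_index m n)"
    using fB by (intro eq_card_imp_inj_on) (simp_all add: finite_block_index)
  have ff: "f (i, k) = (i, \<sigma> i k)" if "(i, k) \<in> block_index m n" for i k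
  proof -
    have "fst (f (i, k)) = i" using f that by (auto simp: fiber_perms_def PiE_iff)
    then show ?thesis using that by (simp add: \<sigma>_def prod_eq_iff)
  qed
  have "\<sigma> i permutes {1..n i}" if i: "i \<in> {1..m}" for i
  proof (rule bij_imp_permutes)
    have B: "(i, k) \<in> block_index m n \<longleftrightarrow> k \<in> {1..n i}" for k using i by (auto simp: block_index_def)
    show "\<sigma> i k = k" if "k \<notin> {1..n i}" for k by (simp only: \<sigma>_def B that if_False)
    have "\<sigma> i k \<in> {1..n i}" if "k \<in> {1..n i}" for k
      using ff[of i k] fB that B by (metis imageI)
    moreover have "inj_on (\<sigma> i) {1..n i}"
    proof (rule inj_onI)
      fix k l assume "k \<in> {1..n i}" "l \<in> {1..n i}" "\<sigma> i k = \<sigma> i l"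
      then show "k = l" using inj_onD[OF inj, of "(i, k)" "(i, l)"] ff B by simp
    qed
    ultimately show "bij_betw (\<sigma> i) {1..n i} {1..n i}"
      unfolding bij_betw_def by (intro conjI endo_inj_surj) auto
  qed
  then have "T (\<lambda>(i, k)\<in>block_index m n. x (i, \<sigma> i k)) = T x"
    using T x unfolding block_symmetric_def by blast
  moreover have "(\<lambda>(i, k)\<in>block_index m n. x (i, \<sigma> i k)) = (\<lambda>b\<in>block_index m n. x (f b))"
    by (rule restrict_ext) (use ff in \<open>auto split: prod.split\<close>)
  ultimately show ?thesis by simp
qed

locale multi_polynomial =
  fixes K :: "complex set" and m :: nat and n :: "nat \<Rightarrow> nat"
    and E :: "nat \<Rightarrow> 'a normed_module" and F :: "'b normed_module" and P :: "(nat \<Rightarrow> 'a) \<Rightarrow> 'b"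
  assumes normed_E: "i \<in> {1..m} \<Longrightarrow> normed_space K (E i)"
    and normed_F: "normed_space K F"
    and P: "P \<in> MP K m n E F"
begin

sublocale F: normed_space K F by (rule normed_F)

abbreviation B where "B \<equiv> block_index m n"

lemma B_fst: "c \<in> B \<Longrightarrow> fst c \<in> {1..m}"
  by (auto simp: block_index_def)

lemma P_mem: "z \<in> space_prod {1..m} E \<Longrightarrow> P z \<in> carrier F"
  using P by (auto simp: MP_def)

lemma P_homogeneous:
  "i \<in> {1..m} \<Longrightarrow> z \<in> space_prod {1..m} E \<Longrightarrow> homogeneous_polynomial K (n i) (E i) F (\<lambda>v. P (z(i := v)))"
  using P by (auto simp: MP_def)

section \<open>The polarization sum: values and linearity in each argument\<close>

lemma block_sum_mem:
  assumes "x \<in> space_prod B (E \<circ> fst)" "S \<subseteq> B" "i \<in> {1..m}"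
  shows "finsum (E i) x {c \<in> S. fst c = i} \<in> carrier (E i)"
proof -
  interpret normed_space K "E i" using assms by (intro normed_E)
  have "x c \<in> carrier (E i)" if "c \<in> {c \<in> S. fst c = i}" for c
    using PiE_mem[OF assms(1), of c] that assms(2) by auto
  then show ?thesis by (rule finsum_mem)
qed

lemma block_sums_mem:
  assumes "x \<in> space_prod B (E \<circ> fst)" "S \<subseteq> B"
  shows "block_sums m E S x \<in> space_prod {1..m} E"
  using block_sum_mem[OF assms] by (simp add: block_sums_def)

lemma polar_sum_mem: "x \<in> space_prod B (E \<circ> fst) \<Longrightarrow> polar_sum m n E F P x \<in> carrier F"
  unfolding polar_sum_def by (intro F.finsum_mem F.scale_closed P_mem block_sums_mem) auto

text \<open>Each subset of \<open>B\<close> splits into a part in block \<open>i\<close> and a part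
  \<open>S'\<close> outside it. For fixed \<open>S'\<close> the variables other than the
  \<open>i\<close>-th do not depend on \<open>v\<close>, and the inner sum is the one-variable
  polarization of \<open>P\<close> in its \<open>i\<close>-th variable, which is linear in
  \<open>v\<close>. The signs multiply because the sizes of the two complements add up.\<close>

lemma polar_sum_linear:
  assumes i: "i \<in> {1..m}" and k: "k \<in> {1..n i}" and x: "x \<in> space_prod B (E \<circ> fst)"
  shows "linear_map K (E i) F (\<lambda>v. polar_sum m n E F P (x((i, k) := v)))"
proof -
  interpret Ei: normed_space K "E i" by (rule normed_E[OF i])
  define B' where "B' = {c \<in> B. fst c \<noteq> i}"
  define J where "J = {1..n i}"
  define w where "w v j = (if j = k then v else x (i, j))" for v j
  \<comment> \<open>\<open>S'\<close> has no position in block \<open>i\<close>, so coordinate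
    \<open>i\<close> of \<open>z S'\<close> is an empty sum; it is overwritten wherever
    \<open>P\<close> is applied.\<close>
  define z where "z S' = block_sums m E S' x" for S'
  define D where "D S' v = (\<Oplus>\<^bsub>F\<^esub>S\<in>Pow J. (-1) ^ card (J - S) \<odot>\<^bsub>F\<^esub> P ((z S')(i := finsum (E i) (w v) S)))"
    for S' v
  have finB: "finite B" "finite B'" "finite J" by (auto simp: finite_block_index B'_def J_def)
  have B: "B = Pair i ` J \<union> B'" "Pair i ` J \<inter> B' = {}"
    using i by (auto simp: block_index_def B'_def J_def)
  have xJ: "x (i, j) \<in> carrier (E i)" if "j \<in> J" for j
    using PiE_mem[OF x, of "(i, j)"] that B by auto
  have z: "z S' \<in> space_prod {1..m} E" if "S' \<subseteq> B'" for S'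
    unfolding z_def using that B by (intro block_sums_mem[OF x]) auto
  have upd: "x((i, k) := v) \<in> space_prod B (E \<circ> fst)" if "v \<in> carrier (E i)" for v
  proof -
    have "(i, k) \<in> B" using B k by (auto simp: J_def)
    then show ?thesis using PiE_fun_upd[OF _ x, of v "(i, k)"] that by (simp add: insert_absorb)
  qed
  have sums: "block_sums m E (Pair i ` S \<union> S') (x((i, k) := v)) = (z S')(i := finsum (E i) (w v) S)"
    if S: "S \<subseteq> J" and S': "S' \<subseteq> B'" and v: "v \<in> carrier (E i)" for S S' v
  proof
    fix j
    have wv: "w v l \<in> carrier (E i)" if "l \<in> S" for l using that S v xJ by (auto simp: w_def)
    consider "j = i" | "j \<noteq> i" "j \<in> {1..m}" | "j \<notin> {1..m}" by blast
    then show "block_sums m E (Pair i ` S \<union> S') (x((i, k) := v)) j = ((z S')(i := finsum (E i) (w v) S)) j"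
    proof cases
      case 1
      have "{c \<in> Pair i ` S \<union> S'. fst c = i} = Pair i ` S" using S' by (auto simp: B'_def)
      then have "block_sums m E (Pair i ` S \<union> S') (x((i, k) := v)) j =
          finsum (E i) (x((i, k) := v)) (Pair i ` S)"
        using 1 i by (simp add: block_sums_def)
      also have "\<dots> = finsum (E i) (\<lambda>j. (x((i, k) := v)) (i, j)) S"
        using S v xJ by (intro Ei.finsum_reindex) (auto simp: inj_on_def)
      also have "\<dots> = finsum (E i) (w v) S"
        using wv by (intro Ei.finsum_eqI) (auto simp: w_def)
      finally show ?thesis using 1 by simp
    next
      case 2
      interpret Ej: normed_space K "E j" by (rule normed_E[OF 2(2)])
      have "{c \<in> Pair i ` S \<union> S'. fst c = j} = {c \<in> S'. fst c = j}" using 2 by auto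
      moreover have "finsum (E j) (x((i, k) := v)) {c \<in> S'. fst c = j} = finsum (E j) x {c \<in> S'. fst c = j}"
      proof (rule Ej.finsum_eqI)
        fix c assume c: "c \<in> {c \<in> S'. fst c = j}"
        then show "(x((i, k) := v)) c = x c" using 2 by auto
        have "c \<in> B" "fst c = j" using c S' by (auto simp: B'_def)
        then show "x c \<in> carrier (E j)" using PiE_mem[OF x, of c] by auto
      qed
      ultimately show ?thesis using 2 by (simp add: block_sums_def z_def)
    next
      case 3
      then show ?thesis using i by (auto simp: block_sums_def z_def)
    qed
  qed
  have lin: "linear_map K (E i) F (D S')" if "S' \<subseteq> B'" for S'
    unfolding D_def w_def J_def
    using homogeneous_polynomial_polar_linear[OF P_homogeneous[OF i z[OF that]] normed_E[OF i] normed_F k,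
      of "\<lambda>j. x (i, j)"] xJ
    by (simp add: J_def)
  have "polar_sum m n E F P (x((i, k) := v)) =
      (\<Oplus>\<^bsub>F\<^esub>S'\<in>Pow B'. (-1) ^ card (B' - S') \<odot>\<^bsub>F\<^esub> D S' v)" if v: "v \<in> carrier (E i)" for v
  proof -
    define t where "t S = (-1) ^ card (B - S) \<odot>\<^bsub>F\<^esub> P (block_sums m E S (x((i, k) := v)))" for S
    \<comment> \<open>\<open>h\<close> joins the two parts of a subset of \<open>B\<close>;
      splitting is its inverse, so pairs of parts index \<open>Pow B\<close>.\<close>
    define h where "h = (\<lambda>(S' :: (nat \<times> nat) set, S :: nat set). Pair i ` S \<union> S')"
    have t: "t S \<in> carrier F" if "S \<subseteq> B" for S
      unfolding t_def using that upd[OF v] by (intro F.scale_closed P_mem block_sums_mem) auto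
    have h: "h q \<subseteq> B" if "q \<in> Pow B' \<times> Pow J" for q
      using that B(1) by (auto simp: h_def)
    have "inj_on h (Pow B' \<times> Pow J)"
    proof (rule inj_on_inverseI)
      fix q assume "q \<in> Pow B' \<times> Pow J"
      then show "(\<lambda>S. (S \<inter> B', {j. (i, j) \<in> S})) (h q) = q"
        using B(2) by (auto simp: h_def B'_def)
    qed
    moreover have "h ` (Pow B' \<times> Pow J) = Pow B"
    proof
      show "h ` (Pow B' \<times> Pow J) \<subseteq> Pow B" using h by auto
      show "Pow B \<subseteq> h ` (Pow B' \<times> Pow J)"
      proof
        fix S assume "S \<in> Pow B"
        then have "S = h (S \<inter> B', {j \<in> J. (i, j) \<in> S})" using B(1) by (auto simp: h_def)
        then show "S \<in> h ` (Pow B' \<times> Pow J)" by blast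
      qed
    qed
    ultimately have "polar_sum m n E F P (x((i, k) := v)) = finsum F (\<lambda>q. t (h q)) (Pow B' \<times> Pow J)"
      using F.finsum_reindex[of t h "Pow B' \<times> Pow J"] t unfolding polar_sum_def t_def[symmetric] by auto
    also have "\<dots> = (\<Oplus>\<^bsub>F\<^esub>S'\<in>Pow B'. \<Oplus>\<^bsub>F\<^esub>S\<in>Pow J. t (h (S', S)))"
      using finB t h by (intro F.finsum_Times) auto
    also have "\<dots> = (\<Oplus>\<^bsub>F\<^esub>S'\<in>Pow B'. (-1) ^ card (B' - S') \<odot>\<^bsub>F\<^esub> D S' v)"
    proof (rule F.finsum_eqI)
      fix S' assume S': "S' \<in> Pow B'"
      show "(-1) ^ card (B' - S') \<odot>\<^bsub>F\<^esub> D S' v \<in> carrier F"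
        using lin[of S'] S' v by (intro F.scale_closed) (auto simp: linear_map_def)
      have PF: "P ((z S')(i := finsum (E i) (w v) S)) \<in> carrier F" if "S \<in> Pow J" for S
      proof -
        have "Pair i ` S \<union> S' \<subseteq> B" using that S' B(1) by auto
        from P_mem[OF block_sums_mem[OF upd[OF v] this]] show ?thesis using sums[of S S' v] that S' v by simp
      qed
      have "(\<Oplus>\<^bsub>F\<^esub>S\<in>Pow J. t (h (S', S))) = (\<Oplus>\<^bsub>F\<^esub>S\<in>Pow J. (-1) ^ card (B' - S') \<odot>\<^bsub>F\<^esub>
          ((-1) ^ card (J - S) \<odot>\<^bsub>F\<^esub> P ((z S')(i := finsum (E i) (w v) S))))"
      proof (rule F.finsum_eqI)
        fix S assume S: "S \<in> Pow J"
        have "B - h (S', S) = Pair i ` (J - S) \<union> (B' - S')"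
          using B S S' by (auto simp: h_def)
        moreover have "card (Pair i ` (J - S) \<union> (B' - S')) = card (B' - S') + card (J - S)"
          using B(2) finB by (subst card_Un_disjoint) (auto simp: card_image inj_on_def)
        ultimately have "card (B - h (S', S)) = card (B' - S') + card (J - S)" by simp
        then show "t (h (S', S)) = (-1) ^ card (B' - S') \<odot>\<^bsub>F\<^esub>
            ((-1) ^ card (J - S) \<odot>\<^bsub>F\<^esub> P ((z S')(i := finsum (E i) (w v) S)))"
          using sums[of S S' v] S S' v PF[OF S] by (simp add: t_def h_def F.scale_scale power_add)
      qed (intro F.scale_closed PF; simp)
      also have "\<dots> = (-1) ^ card (B' - S') \<odot>\<^bsub>F\<^esub> D S' v"
        unfolding D_def using finB PF by (intro F.scale_finsum[symmetric]) auto
      finally show "(\<Oplus>\<^bsub>F\<^esub>S\<in>Pow J. t (h (S', S))) = (-1) ^ card (B' - S') \<odot>\<^bsub>F\<^esub> D S' v" .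
    qed
    finally show ?thesis .
  qed
  moreover have "linear_map K (E i) F (\<lambda>v. \<Oplus>\<^bsub>F\<^esub>S'\<in>Pow B'. (-1) ^ card (B' - S') \<odot>\<^bsub>F\<^esub> D S' v)"
    using lin finB by (intro linear_map_combination[OF normed_F]) auto
  ultimately show ?thesis by (rule linear_map_cong[OF normed_E[OF i], rotated])
qed

section \<open>Multilinearity, symmetry and continuity of the polar form\<close>

abbreviation N where "N \<equiv> card (fiber_perms B fst)"

lemma N_pos: "N > 0"
  by (rule card_fiber_perms_pos[OF finite_block_index])

lemma polar_form_multilinear: "polar_form m n E F P \<in> multilinear_maps K B (E \<circ> fst) F"
  unfolding multilinear_maps_def mem_Collect_eq
proof (intro conjI ballI)
  show "polar_form m n E F P \<in> space_prod B (E \<circ> fst) \<rightarrow>\<^sub>E carrier F"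
    unfolding polar_form_def by (simp add: polar_sum_mem)
next
  fix b x assume b: "b \<in> B" and x: "x \<in> space_prod B (E \<circ> fst)"
  obtain i k where ik: "b = (i, k)" "i \<in> {1..m}" "k \<in> {1..n i}" using b by (auto simp: block_index_def)
  have "linear_map K (E i) F (\<lambda>v. (1 / of_nat N) \<odot>\<^bsub>F\<^esub> polar_sum m n E F P (x((i, k) := v)))"
    by (rule linear_map_scale[OF normed_F polar_sum_linear[OF ik(2,3) x]]) simp
  moreover have "polar_form m n E F P (x((i, k) := v)) =
      (1 / of_nat N) \<odot>\<^bsub>F\<^esub> polar_sum m n E F P (x((i, k) := v))" if "v \<in> carrier (E i)" for v
  proof -
    have "x((i, k) := v) \<in> space_prod B (E \<circ> fst)"
      using PiE_fun_upd[OF _ x, of v "(i, k)"] that b ik(1) by (simp add: insert_absorb)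
    then show ?thesis by (simp add: polar_form_def)
  qed
  ultimately have "linear_map K (E i) F (\<lambda>v. polar_form m n E F P (x((i, k) := v)))"
    by (rule linear_map_cong[OF normed_E[OF ik(2)]])
  then show "linear_map K ((E \<circ> fst) b) F (\<lambda>v. polar_form m n E F P (x(b := v)))" by (simp add: ik(1))
qed

text \<open>The block permutations form one bijection \<open>\<tau>\<close> of \<open>B\<close>. The
  block sums of the permuted arguments over \<open>S\<close> are those of \<open>x\<close> over the
  image of \<open>S\<close>, and taking images permutes \<open>Pow B\<close> and preserves the sizes
  of complements. The polarization sum is therefore merely reindexed.\<close>

lemma polar_form_symmetric: "block_symmetric m n E (polar_form m n E F P)"
  unfolding block_symmetric_def
proof (intro ballI allI impI)
  fix x \<sigma> assume x: "x \<in> space_prod B (E \<circ> fst)" and \<sigma>: "\<forall>i\<in>{1..m}. \<sigma> i permutes {1..n i}"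
  define \<tau> :: "nat \<times> nat \<Rightarrow> nat \<times> nat" where "\<tau> = (\<lambda>(i, k). (i, \<sigma> i k))"
  define y where "y = (\<lambda>(i, k)\<in>B. x (i, \<sigma> i k))"
  have \<tau>B: "\<tau> c \<in> B" if "c \<in> B" for c
  proof -
    obtain i k where c: "c = (i, k)" "i \<in> {1..m}" "k \<in> {1..n i}" using \<open>c \<in> B\<close> by (auto simp: block_index_def)
    then have "\<sigma> i k \<in> {1..n i}" using \<sigma> permutes_in_image[of "\<sigma> i" "{1..n i}" k] by blast
    then show ?thesis using c by (simp add: \<tau>_def block_index_def)
  qed
  have inj: "inj_on \<tau> B"
  proof (rule inj_onI)
    fix c d assume "c \<in> B" "d \<in> B" "\<tau> c = \<tau> d"
    moreover have "inj (\<sigma> i)" if "i \<in> {1..m}" for i using \<sigma> that permutes_inj by blast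
    ultimately show "c = d" using B_fst[of c] by (auto simp: \<tau>_def split: prod.splits dest: injD)
  qed
  have surj: "\<tau> ` B = B" using \<tau>B by (intro endo_inj_surj inj finite_block_index) auto
  have yc: "y c = x (\<tau> c)" if "c \<in> B" for c using that by (simp add: y_def \<tau>_def split: prod.split)
  have y: "y \<in> space_prod B (E \<circ> fst)"
  proof (rule PiE_I)
    fix c assume c: "c \<in> B"
    have "fst (\<tau> c) = fst c" by (simp add: \<tau>_def split: prod.split)
    then show "y c \<in> carrier ((E \<circ> fst) c)" using PiE_mem[OF x \<tau>B[OF c]] yc[OF c] by simp
  qed (simp add: y_def)
  have sums: "block_sums m E S y = block_sums m E (\<tau> ` S) x" if S: "S \<subseteq> B" for S
    unfolding block_sums_def
  proof (rule restrict_ext)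
    fix i assume i: "i \<in> {1..m}"
    interpret Ei: normed_space K "E i" by (rule normed_E[OF i])
    have mem: "x c \<in> carrier (E i)" if "c \<in> B" "fst c = i" for c
      using PiE_mem[OF x that(1)] that(2) by simp
    have "{c \<in> \<tau> ` S. fst c = i} = \<tau> ` {c \<in> S. fst c = i}"
      by (auto simp: \<tau>_def split: prod.splits)
    moreover have "finsum (E i) x (\<tau> ` {c \<in> S. fst c = i}) = (\<Oplus>\<^bsub>E i\<^esub>c\<in>{c \<in> S. fst c = i}. x (\<tau> c))"
    proof (rule Ei.finsum_reindex)
      show "inj_on \<tau> {c \<in> S. fst c = i}" using S by (intro inj_on_subset[OF inj]) auto
      show "x \<in> \<tau> ` {c \<in> S. fst c = i} \<rightarrow> carrier (E i)"
      proof (rule Pi_I)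
        fix d assume "d \<in> \<tau> ` {c \<in> S. fst c = i}"
        then obtain c where "d = \<tau> c" "c \<in> S" "fst c = i" by blast
        then show "x d \<in> carrier (E i)" using S \<tau>B[of c] by (intro mem) (auto simp: \<tau>_def split: prod.split)
      qed
    qed
    moreover have "finsum (E i) y {c \<in> S. fst c = i} = (\<Oplus>\<^bsub>E i\<^esub>c\<in>{c \<in> S. fst c = i}. x (\<tau> c))"
    proof (rule Ei.finsum_eqI)
      fix c assume c: "c \<in> {c \<in> S. fst c = i}"
      then have "c \<in> B" using S by auto
      then show "y c = x (\<tau> c)" by (rule yc)
      show "x (\<tau> c) \<in> carrier (E i)"
        using \<tau>B[OF \<open>c \<in> B\<close>] c by (intro mem) (auto simp: \<tau>_def split: prod.split)
    qed
    ultimately show "finsum (E i) y {c \<in> S. fst c = i} = finsum (E i) x {c \<in> \<tau> ` S. fst c = i}" by simp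
  qed
  define t where "t = (\<lambda>S. (-1) ^ card (B - S) \<odot>\<^bsub>F\<^esub> P (block_sums m E S x))"
  have t: "t S \<in> carrier F" if "S \<subseteq> B" for S
    unfolding t_def using that x by (intro F.scale_closed P_mem block_sums_mem) auto
  have PowB: "(`) \<tau> ` Pow B = Pow B" using surj by (simp add: image_Pow_surj)
  have "polar_sum m n E F P y = (\<Oplus>\<^bsub>F\<^esub>S\<in>Pow B. t (\<tau> ` S))"
    unfolding polar_sum_def
  proof (rule F.finsum_eqI)
    fix S assume S: "S \<in> Pow B"
    then show "t (\<tau> ` S) \<in> carrier F" using \<tau>B by (intro t) auto
    have "B - \<tau> ` S = \<tau> ` (B - S)" using S surj inj by (simp add: inj_on_image_set_diff[OF inj])
    then have "card (B - \<tau> ` S) = card (B - S)"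
      using inj by (simp add: card_image inj_on_subset[OF inj])
    then show "(-1) ^ card (B - S) \<odot>\<^bsub>F\<^esub> P (block_sums m E S y) = t (\<tau> ` S)"
      using S by (simp add: t_def sums)
  qed
  also have "\<dots> = finsum F t ((`) \<tau> ` Pow B)"
    by (rule F.finsum_reindex[symmetric]) (use t inj in \<open>auto simp: PowB inj_on_image_Pow\<close>)
  also have "\<dots> = polar_sum m n E F P x" unfolding PowB polar_sum_def t_def ..
  finally show "polar_form m n E F P (\<lambda>(i, k)\<in>B. x (i, \<sigma> i k)) = polar_form m n E F P x"
    using x y by (simp add: polar_form_def flip: y_def)
qed

text \<open>Each coordinate of \<open>block_sums\<close> is a finite sum of projections, so every
  term is \<open>P\<close> after a continuous map, and the polar form is a finite linear combination
  of these terms.\<close>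

lemma polar_form_continuous: "continuous_multimap B (E \<circ> fst) F (polar_form m n E F P)"
proof -
  define X where "X = product_topology (\<lambda>c. nrm_topology ((E \<circ> fst) c)) B"
  have nE: "normed_space K ((E \<circ> fst) c)" if "c \<in> B" for c
    using B_fst[OF that] by (simp add: normed_E)
  have X: "topspace X = space_prod B (E \<circ> fst)"
    unfolding X_def topspace_product_topology
    using nE normed_space.topspace_nrm_topology by (intro PiE_cong) blast
  have comp: "continuous_map X (nrm_topology F) (\<lambda>x. P (block_sums m E S x))" if S: "S \<subseteq> B" for S
  proof -
    have "continuous_map X (product_topology (\<lambda>i. nrm_topology (E i)) {1..m}) (block_sums m E S)"
      unfolding continuous_map_componentwise
    proof (intro conjI ballI)
      show "block_sums m E S ` topspace X \<subseteq> extensional {1..m}" by (auto simp: block_sums_def)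
      fix i assume i: "i \<in> {1..m}"
      interpret Ei: normed_space K "E i" by (rule normed_E[OF i])
      have "continuous_map X (nrm_topology (E i)) (\<lambda>x. \<Oplus>\<^bsub>E i\<^esub>c\<in>{c \<in> S. fst c = i}. x c)"
      proof (rule Ei.continuous_map_nrm_finsum)
        show "finite {c \<in> S. fst c = i}" using S finite_subset[OF S finite_block_index] by simp
        fix c assume "c \<in> {c \<in> S. fst c = i}"
        then have "c \<in> B" "fst c = i" using S by auto
        then show "continuous_map X (nrm_topology (E i)) (\<lambda>x. x c)"
          using continuous_map_product_projection[of c B "\<lambda>c. nrm_topology ((E \<circ> fst) c)"]
          by (simp add: X_def)
      qed
      then show "continuous_map X (nrm_topology (E i)) (\<lambda>x. block_sums m E S x i)"
        using i by (simp add: block_sums_def)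
    qed
    moreover have "continuous_map (product_topology (\<lambda>i. nrm_topology (E i)) {1..m}) (nrm_topology F) P"
      using P by (simp add: MP_def continuous_multimap_def)
    ultimately show ?thesis using continuous_map_compose by (fastforce simp: o_def)
  qed
  have "continuous_map X (nrm_topology F) (\<lambda>x. (1 / of_nat N) \<odot>\<^bsub>F\<^esub> polar_sum m n E F P x)"
    unfolding polar_sum_def
    by (intro F.continuous_map_nrm_scale F.continuous_map_nrm_finsum comp) (auto simp: finite_block_index)
  \<comment> \<open>The restriction in \<open>polar_form\<close> is harmless because the product is
    the whole topological space \<open>X\<close>.\<close>
  then have "continuous_map X (nrm_topology F) (polar_form m n E F P)"
    by (rule continuous_map_eq) (simp add: polar_form_def X)
  then show ?thesis by (simp add: continuous_multimap_def X_def)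
qed

section \<open>Values on the diagonal and uniqueness\<close>

lemma P_scale:
  assumes x: "x \<in> space_prod {1..m} E" and c: "\<And>i. i \<in> {1..m} \<Longrightarrow> c i \<in> K"
  shows "P (\<lambda>i\<in>{1..m}. c i \<odot>\<^bsub>E i\<^esub> x i) = (\<Prod>i\<in>{1..m}. c i ^ n i) \<odot>\<^bsub>F\<^esub> P x"
proof -
  have cx: "c i \<odot>\<^bsub>E i\<^esub> x i \<in> carrier (E i)" if "i \<in> {1..m}" for i
  proof -
    interpret normed_space K "E i" by (rule normed_E) fact
    show ?thesis using c[OF that] PiE_mem[OF x that] by simp
  qed
  have "P (\<lambda>i\<in>{1..m}. if i \<in> J then c i \<odot>\<^bsub>E i\<^esub> x i else x i) = (\<Prod>i\<in>J. c i ^ n i) \<odot>\<^bsub>F\<^esub> P x"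
    if "J \<subseteq> {1..m}" for J
    using finite_subset[OF that finite_atLeastAtMost] that
  proof (induction J rule: finite_induct)
    case empty
    have "restrict x {1..m} = x" using x by (rule PiE_restrict)
    then show ?case using P_mem[OF x] by simp
  next
    case (insert j J)
    define z where "z = (\<lambda>i\<in>{1..m}. if i \<in> J then c i \<odot>\<^bsub>E i\<^esub> x i else x i)"
    have j: "j \<in> {1..m}" "x j \<in> carrier (E j)" "c j \<in> K" using insert.prems x c by auto
    have z: "z \<in> space_prod {1..m} E" unfolding z_def using cx x by auto
    \<comment> \<open>Coordinate \<open>j\<close> of \<open>z\<close> is still unscaled, so the
      points before and after scaling it are both updates of \<open>z\<close> at \<open>j\<close>,
      and homogeneity in the \<open>j\<close>-th variable applies.\<close>
    have zj: "z(j := x j) = z" using j(1) insert.hyps by (auto simp: z_def)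
    have "(\<lambda>i\<in>{1..m}. if i \<in> insert j J then c i \<odot>\<^bsub>E i\<^esub> x i else x i) = z(j := c j \<odot>\<^bsub>E j\<^esub> x j)"
      using j(1) insert.hyps by (auto simp: z_def restrict_def)
    then have "P (\<lambda>i\<in>{1..m}. if i \<in> insert j J then c i \<odot>\<^bsub>E i\<^esub> x i else x i) = P (z(j := c j \<odot>\<^bsub>E j\<^esub> x j))"
      by (rule arg_cong)
    also have "\<dots> = c j ^ n j \<odot>\<^bsub>F\<^esub> P (z(j := x j))"
      by (rule homogeneous_polynomial_scale[OF P_homogeneous[OF j(1) z] normed_E[OF j(1)] normed_F j(3,2)])
    also have "P (z(j := x j)) = (\<Prod>i\<in>J. c i ^ n i) \<odot>\<^bsub>F\<^esub> P x"
      unfolding zj unfolding z_def using insert by (intro insert.IH) auto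
    also have "c j ^ n j \<odot>\<^bsub>F\<^esub> \<dots> = (\<Prod>i\<in>insert j J. c i ^ n i) \<odot>\<^bsub>F\<^esub> P x"
    proof -
      have "(\<Prod>i\<in>J. c i ^ n i) \<in> K" using insert.prems c by (intro F.scalar_prod F.scalar_simps) auto
      then show ?thesis using insert.hyps j(3) P_mem[OF x] by (simp add: F.scale_scale)
    qed
    finally show ?case .
  qed
  from this[of "{1..m}"] show ?thesis by (simp cong: restrict_cong)
qed

text \<open>On the diagonal the sum over the positions of \<open>S\<close> in block \<open>i\<close>
  is a multiple of \<open>x i\<close> by their number. Homogeneity pulls these numbers out of
  \<open>P\<close>, and \<open>signed_card_fiber_maps\<close> evaluates the resulting coefficient as
  \<open>N\<close>, which the normalization cancels.\<close>

lemma polar_form_diagonal: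
  assumes x: "x \<in> space_prod {1..m} E"
  shows "polar_form m n E F P (\<lambda>(i, k)\<in>B. x i) = P x"
proof -
  define y :: "nat \<times> nat \<Rightarrow> 'a" where "y = (\<lambda>(i, k)\<in>B. x i)"
  define a :: "(nat \<times> nat) set \<Rightarrow> complex"
    where "a S = (-1) ^ card (B - S) * (\<Prod>b\<in>B. of_nat (card {c \<in> S. fst c = fst b}))" for S
  have aK: "a S \<in> K" for S unfolding a_def by (intro F.scalar_simps F.scalar_prod)
  have yc: "y c = x (fst c)" if "c \<in> B" for c using that by (simp add: y_def split: prod.split)
  have y: "y \<in> space_prod B (E \<circ> fst)"
    by (rule PiE_I) (use yc PiE_mem[OF x B_fst] in \<open>auto simp: y_def\<close>)
  have "polar_sum m n E F P y = (\<Oplus>\<^bsub>F\<^esub>S\<in>Pow B. a S \<odot>\<^bsub>F\<^esub> P x)"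
    unfolding polar_sum_def
  proof (rule F.finsum_eqI)
    fix S assume S: "S \<in> Pow B"
    show "a S \<odot>\<^bsub>F\<^esub> P x \<in> carrier F" using aK P_mem[OF x] by simp
    define q :: "nat \<Rightarrow> complex" where "q i = of_nat (card {c \<in> S. fst c = i})" for i
    have qK: "q i \<in> K" for i by (simp add: q_def)
    have "block_sums m E S y = (\<lambda>i\<in>{1..m}. q i \<odot>\<^bsub>E i\<^esub> x i)"
      unfolding block_sums_def
    proof (rule restrict_ext)
      fix i assume i: "i \<in> {1..m}"
      interpret Ei: normed_space K "E i" by (rule normed_E[OF i])
      have xi: "x i \<in> carrier (E i)" by (rule PiE_mem[OF x i])
      have "finsum (E i) y {c \<in> S. fst c = i} = (\<Oplus>\<^bsub>E i\<^esub>c\<in>{c \<in> S. fst c = i}. x i)"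
        using S xi by (intro Ei.finsum_eqI) (auto simp: yc)
      also have "\<dots> = q i \<odot>\<^bsub>E i\<^esub> x i"
        unfolding q_def using S xi finite_subset[of S B]
        by (intro Ei.finsum_const_scale) (auto simp: finite_block_index)
      finally show "finsum (E i) y {c \<in> S. fst c = i} = q i \<odot>\<^bsub>E i\<^esub> x i" .
    qed
    then have "P (block_sums m E S y) = (\<Prod>i\<in>{1..m}. q i ^ n i) \<odot>\<^bsub>F\<^esub> P x"
      using P_scale[OF x qK] by simp
    \<comment> \<open>Block \<open>i\<close> has exactly \<open>n i\<close> positions, so the powers
      become one factor for each position, the form used in
      \<open>signed_card_fiber_maps\<close>.\<close>
    also have "(\<Prod>i\<in>{1..m}. q i ^ n i) = (\<Prod>i\<in>{1..m}. \<Prod>k\<in>{1..n i}. q i)" by simp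
    also have "\<dots> = (\<Prod>b\<in>B. q (fst b))"
      unfolding block_index_def by (subst prod.Sigma) (auto simp: case_prod_unfold)
    finally show "(-1) ^ card (B - S) \<odot>\<^bsub>F\<^esub> P (block_sums m E S y) = a S \<odot>\<^bsub>F\<^esub> P x"
      using P_mem[OF x] qK by (simp add: a_def q_def F.scale_scale)
  qed
  also have "\<dots> = (\<Sum>S\<in>Pow B. a S) \<odot>\<^bsub>F\<^esub> P x"
    using aK P_mem[OF x] by (intro F.finsum_scale_left) (auto simp: finite_block_index)
  also have "(\<Sum>S\<in>Pow B. a S) = of_nat N"
    unfolding a_def by (rule signed_card_fiber_maps[OF finite_block_index])
  finally have "polar_form m n E F P y = (1 / of_nat N) \<odot>\<^bsub>F\<^esub> (of_nat N \<odot>\<^bsub>F\<^esub> P x)"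
    using y by (simp add: polar_form_def)
  also have "\<dots> = P x" using N_pos P_mem[OF x] by (simp add: F.scale_scale)
  finally show ?thesis by (simp add: y_def)
qed

text \<open>The diagonal condition at the block sums rewrites the polarization sum of
  \<open>P\<close> in terms of \<open>T\<close>. By \<open>polarization_formula\<close> it is the
  sum of \<open>T\<close> over all block-preserving rearrangements of \<open>x\<close>, and symmetry
  makes each of these \<open>N\<close> terms equal to \<open>T x\<close>.\<close>

lemma polar_form_unique:
  assumes T: "T \<in> multilinear_maps K B (E \<circ> fst) F" and sym: "block_symmetric m n E T"
    and diag: "\<And>x. x \<in> space_prod {1..m} E \<Longrightarrow> P x = T (\<lambda>(i, k)\<in>B. x i)"
  shows "T = polar_form m n E F P"
proof (rule extensionalityI)
  show "T \<in> extensional (space_prod B (E \<circ> fst))"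
    using T unfolding multilinear_maps_def by (simp add: PiE_def)
  show "polar_form m n E F P \<in> extensional (space_prod B (E \<circ> fst))" by (simp add: polar_form_def)
  fix x assume x: "x \<in> space_prod B (E \<circ> fst)"
  have Tx: "T x \<in> carrier F" by (rule multilinear_map_mem[OF T x])
  have PT: "P (block_sums m E S x) = T (\<lambda>b\<in>B. finsum (E (fst b)) x {c \<in> S. fst c = fst b})"
    if S: "S \<subseteq> B" for S
  proof -
    \<comment> \<open>The diagonal point puts at every position the sum belonging to its block,
      which is the argument of \<open>A\<close> in \<open>polarization_formula\<close>.\<close>
    have "(\<lambda>(i, k)\<in>B. block_sums m E S x i) = (\<lambda>b\<in>B. finsum (E (fst b)) x {c \<in> S. fst c = fst b})"
    proof (rule restrict_ext)
      fix b assume "b \<in> B"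
      then show "(case b of (i, k) \<Rightarrow> block_sums m E S x i) = finsum (E (fst b)) x {c \<in> S. fst c = fst b}"
        using B_fst[of b] by (simp add: block_sums_def case_prod_unfold)
    qed
    then show ?thesis using diag[OF block_sums_mem[OF x S]] by (simp only:)
  qed
  have "polar_sum m n E F P x = (\<Oplus>\<^bsub>F\<^esub>S\<in>Pow B. (-1) ^ card (B - S) \<odot>\<^bsub>F\<^esub>
      T (\<lambda>b\<in>B. finsum (E (fst b)) x {c \<in> S. fst c = fst b}))"
    unfolding polar_sum_def
  proof (rule F.finsum_eqI)
    fix S assume S: "S \<in> Pow B"
    then have PS: "P (block_sums m E S x) \<in> carrier F" by (intro P_mem block_sums_mem[OF x]) auto
    show "(-1) ^ card (B - S) \<odot>\<^bsub>F\<^esub> P (block_sums m E S x) =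
        (-1) ^ card (B - S) \<odot>\<^bsub>F\<^esub> T (\<lambda>b\<in>B. finsum (E (fst b)) x {c \<in> S. fst c = fst b})"
      using S by (simp only: PT Pow_iff)
    show "(-1) ^ card (B - S) \<odot>\<^bsub>F\<^esub> T (\<lambda>b\<in>B. finsum (E (fst b)) x {c \<in> S. fst c = fst b}) \<in> carrier F"
      using PS S unfolding PT[OF S[unfolded Pow_iff]] by (intro F.scale_closed) auto
  qed
  also have "\<dots> = (\<Oplus>\<^bsub>F\<^esub>f\<in>fiber_perms B fst. T (\<lambda>b\<in>B. x (f b)))"
    using B_fst normed_E by (intro polarization_formula[OF T normed_F _ finite_block_index x]) blast
  also have "\<dots> = (\<Oplus>\<^bsub>F\<^esub>f\<in>fiber_perms B fst. T x)"
    using Tx symmetric_fiber_perm[OF sym _ x] by (intro F.finsum_eqI)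
  also have "\<dots> = of_nat N \<odot>\<^bsub>F\<^esub> T x"
    using Tx by (intro F.finsum_const_scale finite_fiber_perms finite_block_index)
  finally have "polar_form m n E F P x = (1 / of_nat N) \<odot>\<^bsub>F\<^esub> (of_nat N \<odot>\<^bsub>F\<^esub> T x)"
    using x by (simp add: polar_form_def)
  also have "\<dots> = T x" using N_pos Tx by (simp add: F.scale_scale)
  finally show "T x = polar_form m n E F P x" ..
qed

end

theorem proposition2p10:
  fixes K :: "complex set" and m :: nat and n :: "nat \<Rightarrow> nat"
    and E :: "nat \<Rightarrow> 'a normed_module" and F :: "'b normed_module"
    and P :: "(nat \<Rightarrow> 'a) \<Rightarrow> 'b"
  assumes "K = \<real> \<or> K = UNIV"
    and "1 \<le> m"
    and "\<And>i. i \<in> {1..m} \<Longrightarrow> 1 \<le> n i"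
    and "\<And>i. i \<in> {1..m} \<Longrightarrow> banach_space K (E i)"
    and "banach_space K F"
    and "P \<in> MP K m n E F"
  shows "\<exists>!T. T \<in> symmetric_multilinear_maps K m n E F \<and>
    (\<forall>x\<in>space_prod {1..m} E. P x = T (\<lambda>(i, k)\<in>block_index m n. x i))"
proof -
  interpret multi_polynomial K m n E F P
  proof (rule multi_polynomial.intro)
    show "normed_space K (E i)" if "i \<in> {1..m}" for i
      using assms(1) assms(4)[OF that] 
      by (intro normed_space.intro normed_space_axioms.intro banach_space.axioms(1))
    show "normed_space K F"
      using assms(1,5) by (intro normed_space.intro normed_space_axioms.intro banach_space.axioms(1))
  qed fact
  show ?thesis
  proof (rule ex1I)
    show "polar_form m n E F P \<in> symmetric_multilinear_maps K m n E F \<and>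
      (\<forall>x\<in>space_prod {1..m} E. P x = polar_form m n E F P (\<lambda>(i, k)\<in>B. x i))"
      unfolding symmetric_multilinear_maps_def continuous_multilinear_maps_def
      using polar_form_multilinear polar_form_continuous polar_form_symmetric polar_form_diagonal by simp
    show "T = polar_form m n E F P" if "T \<in> symmetric_multilinear_maps K m n E F \<and>
      (\<forall>x\<in>space_prod {1..m} E. P x = T (\<lambda>(i, k)\<in>B. x i))" for T
      using that unfolding symmetric_multilinear_maps_def continuous_multilinear_maps_def
      by (intro polar_form_unique) auto
  qed
qed

end
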